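(* Let $g$ be a weak Solovay function. Then a sequence $A\in2^\omega$ is $\mathrm{K}$-trivial if and only if there is a constant $c$ such that $\mathrm{K}(A\upharpoonright n)\le g(n)+c$ for all $n$.
   Context: $\mathrm{K}$ denotes prefix-free Kolmogorov complexity; $A\upharpoonright n$ is the length-$n$ prefix of $A$. $A$ is $\mathrm{K}$-trivial if there is $c$ with $\mathrm{K}(A\upharpoonright n)\le\mathrm{K}(n)+c$ for all $n$. A weak Solovay function is a right-c.e. function $g\colon\mathbb{N}\to\mathbb{N}$ (computably approximable from above) with $\mathrm{K}(n)\le g(n)+O(1)$ for all $n$ and $g(n)\le\mathrm{K}(n)+O(1)$ for infinitely many $n$. *)

theory Defs
  imports Main "HOL-Library.Nat_Bijection" "HOL-Library.Extended_Nat" "HOL-Library.Sublist"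
begin

section \<open>Partial recursive functions\<close>

text \<open>
  Kleene's schemes (zero, successor, projections, composition, primitive recursion, unbounded
  search) for unary functions, several arguments being combined by the Cantor pairing
  function \<^const>\<open>prod_encode\<close>. This yields exactly the unary partial recursive functions.
\<close>

primrec prim_recursion :: "(nat \<rightharpoonup> nat) \<Rightarrow> (nat \<rightharpoonup> nat) \<Rightarrow> nat \<Rightarrow> nat \<Rightarrow> nat option" where
  "prim_recursion f g x 0 = f x"
| "prim_recursion f g x (Suc n) =
     Option.bind (prim_recursion f g x n) (\<lambda>r. g (prod_encode (x, prod_encode (n, r))))"

text \<open>The search diverges if it meets an undefined value before the first zero.\<close>

definition mu_search :: "(nat \<rightharpoonup> nat) \<Rightarrow> nat \<rightharpoonup> nat" where
  "mu_search f x =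
     (if \<exists>n. f (prod_encode (x, n)) = Some 0 \<and> (\<forall>m<n. f (prod_encode (x, m)) \<noteq> None)
      then Some (LEAST n. f (prod_encode (x, n)) = Some 0) else None)"

inductive partial_recursive :: "(nat \<rightharpoonup> nat) \<Rightarrow> bool" where
  zero: "partial_recursive (\<lambda>x. Some 0)"
| succ: "partial_recursive (\<lambda>x. Some (Suc x))"
| left: "partial_recursive (\<lambda>x. Some (fst (prod_decode x)))"
| right: "partial_recursive (\<lambda>x. Some (snd (prod_decode x)))"
| pair: "partial_recursive f \<Longrightarrow> partial_recursive g \<Longrightarrow>
    partial_recursive (\<lambda>x. Option.bind (f x) (\<lambda>a. Option.bind (g x) (\<lambda>b. Some (prod_encode (a, b)))))"
| comp: "partial_recursive f \<Longrightarrow> partial_recursive g \<Longrightarrow>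
    partial_recursive (\<lambda>x. Option.bind (f x) g)"
| prec: "partial_recursive f \<Longrightarrow> partial_recursive g \<Longrightarrow>
    partial_recursive (\<lambda>z. prim_recursion f g (fst (prod_decode z)) (snd (prod_decode z)))"
| search: "partial_recursive f \<Longrightarrow> partial_recursive (mu_search f)"

definition computable2 :: "(nat \<Rightarrow> nat \<Rightarrow> nat) \<Rightarrow> bool" where
  "computable2 h \<longleftrightarrow>
     partial_recursive (\<lambda>z. Some (h (fst (prod_decode z)) (snd (prod_decode z))))"


section \<open>Binary strings and numbers\<close>

text \<open>
  The length-lexicographic identification of finite binary strings with natural numbers:
  \<open>n + 1\<close> is the number with binary expansion \<open>1\<sigma>\<close>, most significant bit first.
\<close>

definition str_code :: "bool list \<Rightarrow> nat" where
  "str_code \<sigma> = foldl (\<lambda>n b. 2 * n + (if b then 2 else 1)) 0 \<sigma>"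

lemma bij_str_code: "bij str_code"
proof (rule bijI)
  have snoc: "str_code (\<sigma> @ [b]) = 2 * str_code \<sigma> + (if b then 2 else 1)" for \<sigma> b
    by (simp add: str_code_def)
  have nil: "str_code [] = 0"
    by (simp add: str_code_def)
  show "inj str_code"
  proof (rule injI)
    fix \<sigma> \<tau> assume "str_code \<sigma> = str_code \<tau>"
    then show "\<sigma> = \<tau>"
    proof (induction \<sigma> arbitrary: \<tau> rule: rev_induct)
      case Nil
      then show ?case by (cases \<tau> rule: rev_cases) (auto simp: snoc nil split: if_splits)
    next
      case (snoc b \<sigma>)
      show ?case
      proof (cases \<tau> rule: rev_cases)
        case Nil
        with snoc.prems show ?thesis by (auto simp: \<open>\<And>\<sigma> b. str_code (\<sigma> @ [b]) = _\<close> nil split: if_splits)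
      next
        case (snoc \<tau>' b')
        have "2 * str_code \<sigma> + (if b then 2 else 1) = 2 * str_code \<tau>' + (if b' then 2 else 1)"
          using snoc.prems snoc \<open>str_code (\<sigma> @ [b]) = str_code \<tau>\<close>
          by (simp only: \<open>\<And>\<sigma> b. str_code (\<sigma> @ [b]) = _\<close>)
        then have "b = b' \<and> str_code \<sigma> = str_code \<tau>'"
          by (cases b; cases b'; simp; presburger)
        then show ?thesis using snoc.IH snoc by simp
      qed
    qed
  qed
  have "\<exists>\<sigma>. str_code \<sigma> = n" for n
  proof (induction n rule: less_induct)
    case (less n)
    show ?case
    proof (cases "n = 0")
      case True
      then show ?thesis using nil by blast
    next
      case False
      then obtain \<sigma> where \<sigma>: "str_code \<sigma> = (n - 1) div 2"
        using less[of "(n - 1) div 2"] by fastforce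
      have "str_code (\<sigma> @ [even n]) = n"
        unfolding snoc \<sigma> using False by (cases "even n") (auto; presburger)+
      then show ?thesis by blast
    qed
  qed
  then show "surj str_code" by (metis surjI)
qed

definition nat_str :: "nat \<Rightarrow> bool list" where
  "nat_str = inv str_code"


section \<open>Prefix-free Kolmogorov complexity\<close>

definition computable_machine :: "(bool list \<rightharpoonup> bool list) \<Rightarrow> bool" where
  "computable_machine M \<longleftrightarrow>
     partial_recursive (\<lambda>n. map_option str_code (M (nat_str n)))"

definition prefix_free_machine :: "(bool list \<rightharpoonup> bool list) \<Rightarrow> bool" where
  "prefix_free_machine M \<longleftrightarrow>
     computable_machine M \<and> (\<forall>p\<in>dom M. \<forall>q\<in>dom M. prefix p q \<longrightarrow> p = q)"

text \<open>The value is \<open>\<infinity>\<close> for strings without description.\<close>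

definition K_machine :: "(bool list \<rightharpoonup> bool list) \<Rightarrow> bool list \<Rightarrow> enat" where
  "K_machine M \<sigma> = (INF p\<in>{p. M p = Some \<sigma>}. enat (length p))"

text \<open>
  Prefix-free Kolmogorov complexity is \<^term>\<open>K_machine U\<close> for an optimal prefix-free
  machine \<open>U\<close>; different choices of \<open>U\<close> change it by at most an additive constant.
\<close>

definition optimal_prefix_free_machine :: "(bool list \<rightharpoonup> bool list) \<Rightarrow> bool" where
  "optimal_prefix_free_machine U \<longleftrightarrow>
     prefix_free_machine U \<and>
     (\<forall>M. prefix_free_machine M \<longrightarrow>
        (\<exists>c::nat. \<forall>\<sigma>. K_machine U \<sigma> \<le> K_machine M \<sigma> + enat c))"

definition K_nat :: "(bool list \<rightharpoonup> bool list) \<Rightarrow> nat \<Rightarrow> enat" where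
  "K_nat U n = K_machine U (nat_str n)"

definition seq_prefix :: "(nat \<Rightarrow> bool) \<Rightarrow> nat \<Rightarrow> bool list" (infixl "\<restriction>" 75) where
  "A \<restriction> n = map A [0..<n]"

definition K_trivial :: "(bool list \<rightharpoonup> bool list) \<Rightarrow> (nat \<Rightarrow> bool) \<Rightarrow> bool" where
  "K_trivial U A \<longleftrightarrow> (\<exists>c::nat. \<forall>n. K_machine U (A \<restriction> n) \<le> K_nat U n + enat c)"


section \<open>Weak Solovay functions\<close>

definition right_ce :: "(nat \<Rightarrow> nat) \<Rightarrow> bool" where
  "right_ce g \<longleftrightarrow>
     (\<exists>h. computable2 h \<and> (\<forall>n. antimono (h n)) \<and> (\<forall>n. \<exists>s. \<forall>t\<ge>s. h n t = g n))"

definition weak_Solovay_function :: "(bool list \<rightharpoonup> bool list) \<Rightarrow> (nat \<Rightarrow> nat) \<Rightarrow> bool" where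
  "weak_Solovay_function U g \<longleftrightarrow>
     right_ce g \<and>
     (\<exists>c::nat. \<forall>n. K_nat U n \<le> enat (g n + c)) \<and>
     (\<exists>c::nat. \<exists>\<^sub>\<infinity>n. enat (g n) \<le> K_nat U n + enat c)"

end

theory Submission
  imports Defs Complex_Main
begin

text \<open>
  Suppose \<open>K(A \<restriction> m) \<le> g(m) + c\<close> for all \<open>m\<close>. Whenever \<open>U\<close> shows a description of length \<open>l\<close> of a
  number \<open>n\<close>, wait until the approximations to \<open>2\<^sup>-\<^sup>g\<^sup>(\<^sup>m\<^sup>)\<close> with \<open>m \<ge> n\<close> have increased by a total of
  \<open>2\<^sup>-\<^sup>l\<close>, scaled down by \<open>4\<^sup>-\<^sup>d\<close>; descriptions are served one after the other. If a wait never ended,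
  the small increase seen meanwhile would pay for descriptions of length \<open>g(m) - d + O(1)\<close> of almost
  all \<open>m\<close>; as \<open>g\<close> is a weak Solovay function this is impossible for large \<open>d\<close>. For such a \<open>d\<close> every
  wait ends, and by hypothesis descriptions of the strings \<open>A \<restriction> m\<close>, all extending \<open>A \<restriction> n\<close>, cover the
  increase up to the factor \<open>2\<^sup>-\<^sup>c\<close>. Give every string \<open>\<tau>\<close> of length \<open>n\<close> whose extensions cover that
  much a description of length \<open>l + 2 d + c\<close>: the increases belong to disjoint time intervals, so this
  charges no description of \<open>U\<close> more than its own weight.
\<close>

section \<open>Total recursive functions\<close>

abbreviation p1 :: "nat \<Rightarrow> nat" where "p1 z \<equiv> fst (prod_decode z)"
abbreviation p2 :: "nat \<Rightarrow> nat" where "p2 z \<equiv> snd (prod_decode z)"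

definition total_rec :: "(nat \<Rightarrow> nat) \<Rightarrow> bool" where
  "total_rec f \<longleftrightarrow> partial_recursive (\<lambda>x. Some (f x))"

definition decidable :: "(nat \<Rightarrow> bool) \<Rightarrow> bool" where
  "decidable P \<longleftrightarrow> total_rec (\<lambda>x. of_bool (P x))"

named_theorems rec_intros

lemma total_rec_comp:
  assumes "total_rec f" "total_rec g"
  shows "total_rec (\<lambda>x. f (g x))"
  using partial_recursive.comp[of "\<lambda>x. Some (g x)" "\<lambda>x. Some (f x)"] assms
  by (simp add: total_rec_def)

lemma total_rec_id [rec_intros]: "total_rec (\<lambda>x. x)"
  using partial_recursive.pair[OF partial_recursive.left partial_recursive.right]
  by (simp add: total_rec_def)

lemma total_rec_Suc [rec_intros]: "total_rec f \<Longrightarrow> total_rec (\<lambda>x. Suc (f x))"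
  using total_rec_comp[of Suc f] partial_recursive.succ by (simp add: total_rec_def)

lemma total_rec_const [rec_intros]: "total_rec (\<lambda>x. c)"
proof (induction c)
  case 0
  show ?case using partial_recursive.zero by (simp add: total_rec_def)
next
  case (Suc c)
  then show ?case by (rule total_rec_Suc)
qed

lemma total_rec_p1 [rec_intros]: "total_rec f \<Longrightarrow> total_rec (\<lambda>x. p1 (f x))"
  using total_rec_comp[of p1 f] partial_recursive.left by (simp add: total_rec_def)

lemma total_rec_p2 [rec_intros]: "total_rec f \<Longrightarrow> total_rec (\<lambda>x. p2 (f x))"
  using total_rec_comp[of p2 f] partial_recursive.right by (simp add: total_rec_def)

lemma total_rec_pair [rec_intros]:
  "total_rec f \<Longrightarrow> total_rec g \<Longrightarrow> total_rec (\<lambda>x. prod_encode (f x, g x))"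
  using partial_recursive.pair[of "\<lambda>x. Some (f x)" "\<lambda>x. Some (g x)"] by (simp add: total_rec_def)

text \<open>The scheme \<open>prec\<close> with the parameter \<open>x\<close> kept inside
  \<open>step\<close>. Arithmetic only has to be written as a \<open>rec_nat\<close> for closure
  under it to follow.\<close>

lemma total_rec_rec_nat [rec_intros]:
  assumes "total_rec a" "total_rec (\<lambda>z. step (p1 z) (p1 (p2 z)) (p2 (p2 z)))" "total_rec b"
  shows "total_rec (\<lambda>x. rec_nat (a x) (step x) (b x))"
proof -
  have "prim_recursion (\<lambda>x. Some (a x)) (\<lambda>z. Some (step (p1 z) (p1 (p2 z)) (p2 (p2 z)))) x n
      = Some (rec_nat (a x) (step x) n)" for x n
    by (induction n) simp_all
  with partial_recursive.prec[of "\<lambda>x. Some (a x)"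
      "\<lambda>z. Some (step (p1 z) (p1 (p2 z)) (p2 (p2 z)))"] assms
  have "total_rec (\<lambda>z. rec_nat (a (p1 z)) (step (p1 z)) (p2 z))"
    by (simp add: total_rec_def)
  from total_rec_comp[OF this total_rec_pair[OF total_rec_id assms(3)]]
  show ?thesis by simp
qed

lemma total_rec_add [rec_intros]:
  assumes "total_rec f" "total_rec g"
  shows "total_rec (\<lambda>x. f x + g x)"
proof -
  have "rec_nat m (\<lambda>_ r. Suc r) n = m + n" for m n :: nat
    by (induction n) simp_all
  moreover have "total_rec (\<lambda>x. rec_nat (f x) (\<lambda>_ r. Suc r) (g x))"
    by (intro rec_intros assms)
  ultimately show ?thesis by simp
qed

lemma total_rec_mult [rec_intros]:
  assumes "total_rec f" "total_rec g"
  shows "total_rec (\<lambda>x. f x * g x)"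
proof -
  have "rec_nat 0 (\<lambda>_ r. m + r) n = m * n" for m n :: nat
    by (induction n) simp_all
  moreover have "total_rec (\<lambda>x. rec_nat 0 (\<lambda>_ r. f x + r) (g x))"
    by (intro rec_intros assms total_rec_comp[OF assms(1)])
  ultimately show ?thesis by simp
qed

lemma total_rec_power [rec_intros]:
  assumes "total_rec f" "total_rec g"
  shows "total_rec (\<lambda>x. f x ^ g x)"
proof -
  have "rec_nat 1 (\<lambda>_ r. m * r) n = m ^ n" for m n :: nat
    by (induction n) simp_all
  moreover have "total_rec (\<lambda>x. rec_nat 1 (\<lambda>_ r. f x * r) (g x))"
    by (intro rec_intros assms total_rec_comp[OF assms(1)])
  ultimately show ?thesis by simp
qed

lemma total_rec_diff [rec_intros]:
  assumes "total_rec f" "total_rec g"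
  shows "total_rec (\<lambda>x. f x - g x)"
proof -
  have pred: "rec_nat 0 (\<lambda>k _. k) n = n - 1" for n :: nat
    by (cases n) simp_all
  have "total_rec (\<lambda>x. rec_nat 0 (\<lambda>k _. k) x)"
    by (intro rec_intros)
  then have "total_rec (\<lambda>x. x - 1)"
    unfolding pred .
  then have *: "total_rec (\<lambda>x. p2 (p2 x) - 1)"
    by (rule total_rec_comp) (intro rec_intros)
  have "rec_nat m (\<lambda>_ r. r - 1) n = m - n" for m n :: nat
    by (induction n) simp_all
  moreover have "total_rec (\<lambda>x. rec_nat (f x) (\<lambda>_ r. r - 1) (g x))"
    by (intro rec_intros assms *)
  ultimately show ?thesis by simp
qed

lemma total_rec_of_bool [rec_intros]: "decidable P \<Longrightarrow> total_rec (\<lambda>x. of_bool (P x))"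
  by (simp add: decidable_def)

lemma decidable_comp:
  assumes "decidable P" "total_rec f"
  shows "decidable (\<lambda>x. P (f x))"
  using total_rec_comp[of "\<lambda>x. of_bool (P x)" f] assms by (simp add: decidable_def)

lemma decidable_not [rec_intros]:
  assumes "decidable P"
  shows "decidable (\<lambda>x. \<not> P x)"
proof -
  have "total_rec (\<lambda>x. 1 - of_bool (P x))"
    by (intro rec_intros assms)
  moreover have "(\<lambda>x. 1 - of_bool (P x)) = (\<lambda>x. of_bool (\<not> P x) :: nat)"
    by auto
  ultimately show ?thesis by (simp only: decidable_def)
qed

lemma decidable_conj [rec_intros]:
  assumes "decidable P" "decidable Q"
  shows "decidable (\<lambda>x. P x \<and> Q x)"
proof -
  have "total_rec (\<lambda>x. of_bool (P x) * of_bool (Q x))"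
    by (intro rec_intros assms)
  then show ?thesis by (simp add: decidable_def of_bool_conj)
qed

lemma decidable_disj [rec_intros]:
  assumes "decidable P" "decidable Q"
  shows "decidable (\<lambda>x. P x \<or> Q x)"
proof -
  have "decidable (\<lambda>x. \<not> (\<not> P x \<and> \<not> Q x))"
    by (intro rec_intros assms)
  then show ?thesis by simp
qed

lemma decidable_le [rec_intros]:
  assumes "total_rec f" "total_rec g"
  shows "decidable (\<lambda>x. f x \<le> g x)"
proof -
  have *: "1 - (m - n) = (of_bool (m \<le> n) :: nat)" for m n :: nat
    by auto
  have "total_rec (\<lambda>x. 1 - (f x - g x))"
    by (intro rec_intros assms)
  then show ?thesis by (simp only: decidable_def *)
qed

lemma decidable_less [rec_intros]:
  assumes "total_rec f" "total_rec g"
  shows "decidable (\<lambda>x. f x < g x)"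
  using decidable_not[OF decidable_le[OF assms(2,1)]] by (simp add: not_le)

lemma decidable_eq [rec_intros]:
  assumes "total_rec f" "total_rec g"
  shows "decidable (\<lambda>x. f x = g x)"
  using decidable_conj[OF decidable_le[OF assms] decidable_le[OF assms(2,1)]]
  by (simp add: eq_iff)

lemma total_rec_if [rec_intros]:
  assumes "decidable P" "total_rec f" "total_rec g"
  shows "total_rec (\<lambda>x. if P x then f x else g x)"
proof -
  have "total_rec (\<lambda>x. of_bool (P x) * f x + of_bool (\<not> P x) * g x)"
    by (intro rec_intros assms)
  moreover have "(\<lambda>x. of_bool (P x) * f x + of_bool (\<not> P x) * g x)
      = (\<lambda>x. if P x then f x else g x)"
    by auto
  ultimately show ?thesis by simp
qed

lemma total_rec_sum [rec_intros]:
  assumes "total_rec (\<lambda>z. F (p1 z) (p2 z))" "total_rec b"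
  shows "total_rec (\<lambda>x. \<Sum>i<b x. F x i)"
proof -
  have "rec_nat 0 (\<lambda>i r. F x i + r) n = (\<Sum>i<n. F x i)" for x n
    by (induction n) simp_all
  moreover have "total_rec (\<lambda>z. F (p1 z) (p1 (p2 z)))"
    using total_rec_comp[OF assms(1), of "\<lambda>z. prod_encode (p1 z, p1 (p2 z))"]
    by (simp add: rec_intros)
  then have "total_rec (\<lambda>x. rec_nat 0 (\<lambda>i r. F x i + r) (b x))"
    by (intro rec_intros assms)
  ultimately show ?thesis by simp
qed

lemma decidable_bex [rec_intros]:
  assumes "decidable (\<lambda>z. P (p1 z) (p2 z))" "total_rec b"
  shows "decidable (\<lambda>x. \<exists>i<b x. P x i)"
proof -
  have "decidable (\<lambda>x. (0::nat) < (\<Sum>i<b x. of_bool (P x i)))"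
    by (intro rec_intros assms)
  moreover have "0 < (\<Sum>i<n. of_bool (P x i) :: nat) \<longleftrightarrow> (\<exists>i<n. P x i)" for x n
    by (auto simp: sum_eq_0_iff zero_less_iff_neq_zero)
  ultimately show ?thesis by simp
qed

lemma decidable_ball [rec_intros]:
  assumes "decidable (\<lambda>z. P (p1 z) (p2 z))" "total_rec b"
  shows "decidable (\<lambda>x. \<forall>i<b x. P x i)"
proof -
  have "decidable (\<lambda>x. \<not> (\<exists>i<b x. \<not> P x i))"
    by (intro rec_intros assms)
  then show ?thesis by simp
qed

lemma total_rec_div [rec_intros]:
  assumes "total_rec f" "total_rec g"
  shows "total_rec (\<lambda>x. f x div g x)"
proof -
  \<comment> \<open>The quotient counts the positive multiples of \<open>n\<close> up to
    \<open>m\<close>; the conjunct \<open>0 < n\<close> reproduces the convention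
    \<open>m div 0 = 0\<close>.\<close>
  have *: "(\<Sum>i<m. of_bool (0 < n \<and> Suc i * n \<le> m)) = m div n" for m n :: nat
  proof (cases "n = 0")
    case False
    have "Suc i * n \<le> m \<longleftrightarrow> i < m div n" for i
      using less_eq_div_iff_mult_less_eq[of n "Suc i" m] False by (simp add: Suc_le_eq)
    moreover have "i < m" if "i < m div n" for i
      using that div_le_dividend[of m n] by linarith
    ultimately have "{i \<in> {..<m}. 0 < n \<and> Suc i * n \<le> m} = {..<m div n}"
      using False by blast
    then show ?thesis
      by (simp add: Int_def Collect_conj_eq[symmetric] del: mult_Suc)
  qed simp
  have **: "total_rec (\<lambda>x. f (p1 x))" "total_rec (\<lambda>x. g (p1 x))"
    by (intro total_rec_comp[OF assms(1)] total_rec_comp[OF assms(2)] rec_intros)+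
  have "total_rec (\<lambda>x. \<Sum>i<f x. of_bool (0 < g x \<and> Suc i * g x \<le> f x))"
    by (intro rec_intros assms **)
  then show ?thesis unfolding * .
qed

text \<open>The characteristic function is total, so the definedness condition in
  \<open>mu_search\<close> holds automatically and the search finds the least witness. The machine
  built from requests has this form.\<close>

lemma partial_recursive_search:
  assumes "decidable (\<lambda>z. R (p1 z) (p2 z))" "total_rec f"
  shows "partial_recursive
    (\<lambda>x. if \<exists>k. R x k then Some (f (LEAST k. R x k)) else None)"
proof -
  have "partial_recursive (\<lambda>z. Some (of_bool (\<not> R (p1 z) (p2 z))))"
    using decidable_not[OF assms(1)] by (simp add: decidable_def total_rec_def)
  from partial_recursive.comp[OF partial_recursive.search[OF this] assms(2)[unfolded total_rec_def]]
  show ?thesis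
    by (rule back_subst[of partial_recursive]) (auto simp: mu_search_def fun_eq_iff)
qed

section \<open>Step-bounded evaluation\<close>

text \<open>The value \<open>0\<close> of \<open>T x s\<close> means that the computation has not halted within \<open>s\<close> steps.\<close>

definition stepped :: "(nat \<rightharpoonup> nat) \<Rightarrow> (nat \<Rightarrow> nat \<Rightarrow> nat) \<Rightarrow> bool" where
  "stepped f T \<longleftrightarrow> total_rec (\<lambda>z. T (p1 z) (p2 z)) \<and>
     (\<forall>x s v. T x s = Suc v \<longrightarrow> (\<forall>t\<ge>s. T x t = Suc v)) \<and>
     (\<forall>x v. f x = Some v \<longleftrightarrow> (\<exists>s. T x s = Suc v))"

lemma stepped_rec:
  assumes "stepped f T" "total_rec a" "total_rec b"
  shows "total_rec (\<lambda>x. T (a x) (b x))"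
proof -
  have "total_rec (\<lambda>z. T (p1 z) (p2 z))"
    using assms(1) unfolding stepped_def by (rule conjunct1)
  from total_rec_comp[OF this total_rec_pair[OF assms(2,3)]] show ?thesis by simp
qed

lemma stepped_mono:
  assumes "stepped f T" "T x s = Suc v" "s \<le> t"
  shows "T x t = Suc v"
  using assms(1)[unfolded stepped_def, THEN conjunct2, THEN conjunct1] assms(2,3) by blast

lemma stepped_eq: "stepped f T \<Longrightarrow> 0 < T x s \<Longrightarrow> s \<le> t \<Longrightarrow> T x t = T x s"
  using stepped_mono[of f T x s "T x s - 1" t] by simp

lemma stepped_iff:
  assumes "stepped f T"
  shows "f x = Some v \<longleftrightarrow> (\<exists>s. T x s = Suc v)"
  using assms[unfolded stepped_def, THEN conjunct2, THEN conjunct2] by blast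

lemma stepped_total: "total_rec f \<Longrightarrow> stepped (\<lambda>x. Some (f x)) (\<lambda>x s. Suc (f x))"
  using total_rec_Suc[OF total_rec_comp[OF _ total_rec_p1[OF total_rec_id]]]
  unfolding stepped_def by auto

text \<open>Both computations run under one step bound. Halted values persist, so the maximum of two
  halting times serves for both.\<close>

lemma stepped_pair:
  assumes F: "stepped f F" and G: "stepped g G"
  shows "stepped (\<lambda>x. Option.bind (f x) (\<lambda>a. Option.bind (g x) (\<lambda>b. Some (prod_encode (a, b)))))
    (\<lambda>x s. if F x s \<noteq> 0 \<and> G x s \<noteq> 0 then Suc (prod_encode (F x s - 1, G x s - 1)) else 0)"
    (is "stepped ?h ?H")
  unfolding stepped_def
proof (intro conjI allI impI)
  show "total_rec (\<lambda>z. ?H (p1 z) (p2 z))"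
    by (intro rec_intros stepped_rec[OF F] stepped_rec[OF G])
next
  fix x s v t assume "?H x s = Suc v" "s \<le> t"
  then obtain a b where "F x s = Suc a" "G x s = Suc b" "v = prod_encode (a, b)"
    by (cases "F x s"; cases "G x s") auto
  then show "?H x t = Suc v"
    using stepped_mono[OF F _ \<open>s \<le> t\<close>] stepped_mono[OF G _ \<open>s \<le> t\<close>] by simp
next
  fix x v
  show "?h x = Some v \<longleftrightarrow> (\<exists>s. ?H x s = Suc v)"
  proof
    assume "?h x = Some v"
    then obtain a b where ab: "f x = Some a" "g x = Some b" "v = prod_encode (a, b)"
      by (auto simp: bind_eq_Some_conv)
    then obtain s t where st: "F x s = Suc a" "G x t = Suc b"
      using stepped_iff[OF F] stepped_iff[OF G] by blast
    have "F x (max s t) = Suc a" "G x (max s t) = Suc b"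
      using stepped_mono[OF F st(1)] stepped_mono[OF G st(2)] by simp_all
    then show "\<exists>s. ?H x s = Suc v"
      using ab by (intro exI[of _ "max s t"]) simp
  next
    assume "\<exists>s. ?H x s = Suc v"
    then obtain s where "?H x s = Suc v" ..
    then obtain a b where "F x s = Suc a" "G x s = Suc b" "v = prod_encode (a, b)"
      by (cases "F x s"; cases "G x s") auto
    moreover from this have "f x = Some a" "g x = Some b"
      using stepped_iff[OF F] stepped_iff[OF G] by blast+
    ultimately show "?h x = Some v" by simp
  qed
qed

lemma stepped_comp:
  assumes F: "stepped f F" and G: "stepped g G"
  shows "stepped (\<lambda>x. Option.bind (f x) g)
    (\<lambda>x s. if F x s \<noteq> 0 then G (F x s - 1) s else 0)" (is "stepped ?h ?H")
  unfolding stepped_def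
proof (intro conjI allI impI)
  show "total_rec (\<lambda>z. ?H (p1 z) (p2 z))"
    by (intro rec_intros stepped_rec[OF F] stepped_rec[OF G])
next
  fix x s v t assume "?H x s = Suc v" "s \<le> t"
  then obtain a where "F x s = Suc a" "G a s = Suc v"
    by (cases "F x s") auto
  then show "?H x t = Suc v"
    using stepped_mono[OF F _ \<open>s \<le> t\<close>] stepped_mono[OF G _ \<open>s \<le> t\<close>] by simp
next
  fix x v
  show "?h x = Some v \<longleftrightarrow> (\<exists>s. ?H x s = Suc v)"
  proof
    assume "?h x = Some v"
    then obtain a where "f x = Some a" "g a = Some v"
      by (auto simp: bind_eq_Some_conv)
    then obtain s t where st: "F x s = Suc a" "G a t = Suc v"
      using stepped_iff[OF F] stepped_iff[OF G] by blast
    have "F x (max s t) = Suc a" "G a (max s t) = Suc v"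
      using stepped_mono[OF F st(1)] stepped_mono[OF G st(2)] by simp_all
    then show "\<exists>s. ?H x s = Suc v"
      by (intro exI[of _ "max s t"]) simp
  next
    assume "\<exists>s. ?H x s = Suc v"
    then obtain s where "?H x s = Suc v" ..
    then obtain a where "F x s = Suc a" "G a s = Suc v"
      by (cases "F x s") auto
    then have "f x = Some a" "g a = Some v"
      using stepped_iff[OF F] stepped_iff[OF G] by blast+
    then show "?h x = Some v" by simp
  qed
qed

lemma stepped_prec:
  assumes F: "stepped f F" and G: "stepped g G"
  shows "\<exists>H. stepped (\<lambda>z. prim_recursion f g (p1 z) (p2 z)) H"
proof -
  \<comment> \<open>All rounds of the recursion share the bound \<open>s\<close>, and an unfinished
    round, marked by \<open>0\<close>, leaves every later round unfinished.\<close>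
  define R where "R x s n = rec_nat (F x s)
    (\<lambda>k r. if r \<noteq> 0 then G (prod_encode (x, prod_encode (k, r - 1))) s else 0) n" for x s n
  have R_simps: "R x s 0 = F x s"
    "R x s (Suc n) = (if R x s n \<noteq> 0 then G (prod_encode (x, prod_encode (n, R x s n - 1))) s else 0)"
    for x s n
    by (simp_all add: R_def)
  have mono: "R x s n = Suc v \<Longrightarrow> s \<le> t \<Longrightarrow> R x t n = Suc v" for x s t n v
  proof (induction n arbitrary: v)
    case 0
    then show ?case unfolding R_simps by (rule stepped_mono[OF F])
  next
    case (Suc n)
    then obtain r where r: "R x s n = Suc r" "G (prod_encode (x, prod_encode (n, r))) s = Suc v"
      by (cases "R x s n") (auto simp: R_simps)
    then show ?case
      using Suc.IH[OF r(1)] Suc.prems(2) stepped_mono[OF G r(2)] by (simp add: R_simps)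
  qed
  have iff: "prim_recursion f g x n = Some v \<longleftrightarrow> (\<exists>s. R x s n = Suc v)" for x n v
  proof (induction n arbitrary: v)
    case 0
    show ?case by (simp add: R_simps stepped_iff[OF F])
  next
    case (Suc n)
    show ?case
    proof
      assume "prim_recursion f g x (Suc n) = Some v"
      then obtain r where "prim_recursion f g x n = Some r"
        "g (prod_encode (x, prod_encode (n, r))) = Some v"
        by (auto simp: bind_eq_Some_conv)
      then obtain s t where st: "R x s n = Suc r" "G (prod_encode (x, prod_encode (n, r))) t = Suc v"
        using Suc.IH stepped_iff[OF G] by blast
      have "R x (max s t) n = Suc r" "G (prod_encode (x, prod_encode (n, r))) (max s t) = Suc v"
        using mono[OF st(1)] stepped_mono[OF G st(2)] by simp_all
      then show "\<exists>s. R x s (Suc n) = Suc v"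
        by (intro exI[of _ "max s t"]) (simp add: R_simps)
    next
      assume "\<exists>s. R x s (Suc n) = Suc v"
      then obtain s where "R x s (Suc n) = Suc v" ..
      then obtain r where "R x s n = Suc r" "G (prod_encode (x, prod_encode (n, r))) s = Suc v"
        by (cases "R x s n") (auto simp: R_simps)
      then have "prim_recursion f g x n = Some r" "g (prod_encode (x, prod_encode (n, r))) = Some v"
        using Suc.IH stepped_iff[OF G] by blast+
      then show "prim_recursion f g x (Suc n) = Some v" by simp
    qed
  qed
  have "total_rec (\<lambda>z. R (p1 (p1 z)) (p2 z) (p2 (p1 z)))"
    unfolding R_def by (intro rec_intros stepped_rec[OF F] stepped_rec[OF G])
  then have *: "stepped (\<lambda>z. prim_recursion f g (p1 z) (p2 z)) (\<lambda>z s. R (p1 z) s (p2 z))"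
    unfolding stepped_def using mono iff by blast
  show ?thesis by (rule exI) (rule *)
qed

lemma stepped_search:
  assumes F: "stepped f F"
  shows "\<exists>H. stepped (mu_search f) H"
proof -
  \<comment> \<open>Values are shifted by one: \<open>1\<close> says that \<open>f\<close> halted
    with value \<open>0\<close>, and anything above \<open>1\<close> that it halted with a nonzero
    value.\<close>
  define found where
    "found x n s \<longleftrightarrow> F (prod_encode (x, n)) s = 1 \<and> (\<forall>m<n. 1 < F (prod_encode (x, m)) s)" for x n s
  \<comment> \<open>At most one \<open>n\<close> is found at a given stage, so the sum has at most
    one nonzero term and selects \<open>Suc n\<close>.\<close>
  define H where "H x s = (\<Sum>n<s. of_bool (found x n s) * Suc n)" for x s
  have unique: "n = n'" if "found x n s" "found x n' s" for x n n' s
  proof (rule ccontr)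
    have *: "F (prod_encode (x, n)) s = 1" "F (prod_encode (x, n')) s = 1"
      and **: "n < n' \<Longrightarrow> 1 < F (prod_encode (x, n)) s" "n' < n \<Longrightarrow> 1 < F (prod_encode (x, n')) s"
      using that unfolding found_def by blast+
    assume "n \<noteq> n'"
    then have "n < n' \<or> n' < n" by linarith
    then show False using * ** by linarith
  qed
  have H_iff: "H x s = Suc n \<longleftrightarrow> n < s \<and> found x n s" for x s n
  proof -
    have eq: "H x s = Suc n" if "n < s" "found x n s" for n
    proof -
      have "found x k s \<longleftrightarrow> k = n" for k
        using unique[OF _ that(2), of k] that(2) by blast
      then have "H x s = (\<Sum>k<s. if k = n then Suc n else 0)"
        unfolding H_def by (intro sum.cong) auto
      then show ?thesis using that(1) by simp
    qed
    moreover have "\<exists>k. k < s \<and> found x k s" if "H x s = Suc n"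
    proof (rule ccontr)
      assume "\<nexists>k. k < s \<and> found x k s"
      then have "H x s = 0" by (simp add: H_def)
      with that show False by simp
    qed
    ultimately show ?thesis by (metis Suc_inject)
  qed
  have found_mono: "found x n t" if "found x n s" "s \<le> t" for x n s t
  proof -
    have *: "F (prod_encode (x, n)) s = 1" "\<And>m. m < n \<Longrightarrow> 1 < F (prod_encode (x, m)) s"
      using that(1) unfolding found_def by blast+
    have "F (prod_encode (x, n)) t = 1"
      using stepped_eq[OF F _ that(2), of "prod_encode (x, n)"] *(1) by simp
    moreover have "1 < F (prod_encode (x, m)) t" if "m < n" for m
      using stepped_eq[OF F _ \<open>s \<le> t\<close>, of "prod_encode (x, m)"] *(2)[OF that] by simp
    ultimately show ?thesis unfolding found_def by blast
  qed
  have search_iff: "mu_search f x = Some n \<longleftrightarrow> f (prod_encode (x, n)) = Some 0 \<and>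
      (\<forall>m<n. \<exists>v. f (prod_encode (x, m)) = Some (Suc v))" for x n
  proof
    assume *: "mu_search f x = Some n"
    then obtain k where k: "f (prod_encode (x, k)) = Some 0" "\<forall>m<k. f (prod_encode (x, m)) \<noteq> None"
      and n: "n = (LEAST n. f (prod_encode (x, n)) = Some 0)"
      by (auto simp: mu_search_def split: if_splits)
    have "n \<le> k" "f (prod_encode (x, n)) = Some 0"
      unfolding n using k(1) by (auto intro: Least_le LeastI)
    moreover have "\<exists>v. f (prod_encode (x, m)) = Some (Suc v)" if m: "m < n" for m
    proof -
      have "f (prod_encode (x, m)) \<noteq> Some 0"
        using not_less_Least[of m "\<lambda>n. f (prod_encode (x, n)) = Some 0"] m n by blast
      moreover have "m < k" using m \<open>n \<le> k\<close> by simp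
      then obtain v where "f (prod_encode (x, m)) = Some v"
        using k(2) by blast
      ultimately show ?thesis by (cases v) auto
    qed
    ultimately show "f (prod_encode (x, n)) = Some 0 \<and>
      (\<forall>m<n. \<exists>v. f (prod_encode (x, m)) = Some (Suc v))" by blast
  next
    assume *: "f (prod_encode (x, n)) = Some 0 \<and>
      (\<forall>m<n. \<exists>v. f (prod_encode (x, m)) = Some (Suc v))"
    then have "(LEAST n. f (prod_encode (x, n)) = Some 0) = n"
    proof (intro Least_equality)
      fix k assume "f (prod_encode (x, k)) = Some 0"
      then show "n \<le> k" using * by (metis not_less option.inject nat.distinct(1))
    qed blast
    moreover have "\<exists>n. f (prod_encode (x, n)) = Some 0 \<and> (\<forall>m<n. f (prod_encode (x, m)) \<noteq> None)"
      using * by blast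
    ultimately show "mu_search f x = Some n"
      by (simp only: mu_search_def if_True)
  qed
  have "mu_search f x = Some n \<longleftrightarrow> (\<exists>s. H x s = Suc n)" for x n
  proof
    assume "mu_search f x = Some n"
    then have *: "f (prod_encode (x, n)) = Some 0"
      "\<forall>m<n. \<exists>v. f (prod_encode (x, m)) = Some (Suc v)"
      by (simp_all add: search_iff)
    obtain s where s: "F (prod_encode (x, n)) s = Suc 0"
      using *(1) stepped_iff[OF F] by blast
    have "\<forall>m<n. \<exists>s. 1 < F (prod_encode (x, m)) s"
    proof (intro allI impI)
      fix m assume "m < n"
      then obtain v s where "F (prod_encode (x, m)) s = Suc (Suc v)"
        using *(2) unfolding stepped_iff[OF F] by blast
      then show "\<exists>s. 1 < F (prod_encode (x, m)) s"
        by (intro exI[of _ s]) simp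
    qed
    then obtain S where S: "\<And>m. m < n \<Longrightarrow> 1 < F (prod_encode (x, m)) (S m)"
      by metis
    \<comment> \<open>A stage past all the halting times involved; the summand \<open>Suc n\<close>
      puts \<open>n\<close> into the range that \<open>H\<close> inspects.\<close>
    define t where "t = Suc n + s + (\<Sum>m<n. S m)"
    have "1 < F (prod_encode (x, m)) t" if "m < n" for m
    proof -
      have "S m \<le> (\<Sum>m<n. S m)" using that by (intro member_le_sum) auto
      then have "S m \<le> t" by (simp add: t_def)
      then show ?thesis
        using stepped_eq[OF F _ \<open>S m \<le> t\<close>, of "prod_encode (x, m)"] S[OF that] by simp
    qed
    moreover have "F (prod_encode (x, n)) t = 1"
      using stepped_mono[OF F s, of t] by (simp add: t_def)
    ultimately have "found x n t" by (simp add: found_def)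
    then show "\<exists>s. H x s = Suc n"
      unfolding H_iff by (intro exI[of _ t]) (simp add: t_def)
  next
    assume "\<exists>s. H x s = Suc n"
    then obtain s where "found x n s" by (auto simp: H_iff)
    then have *: "F (prod_encode (x, n)) s = 1" "\<And>m. m < n \<Longrightarrow> 1 < F (prod_encode (x, m)) s"
      unfolding found_def by blast+
    have "F (prod_encode (x, n)) s = Suc 0"
      using *(1) by simp
    moreover have "F (prod_encode (x, m)) s = Suc (Suc (F (prod_encode (x, m)) s - 2))"
      if "m < n" for m
      using *(2)[OF that] by linarith
    ultimately show "mu_search f x = Some n"
      unfolding search_iff stepped_iff[OF F] by blast
  qed
  moreover have "total_rec (\<lambda>z. H (p1 z) (p2 z))"
    unfolding H_def found_def by (intro rec_intros stepped_rec[OF F])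
  moreover have "H x t = Suc v" if "H x s = Suc v" "s \<le> t" for x s t v
    using that found_mono by (auto simp: H_iff)
  ultimately have "stepped (mu_search f) H"
    unfolding stepped_def by blast
  then show ?thesis by (intro exI)
qed

lemma partial_recursive_stepped:
  assumes "partial_recursive f"
  shows "\<exists>T. stepped f T"
  using assms
proof induction
  case zero
  show ?case by (rule exI) (rule stepped_total[OF total_rec_const])
next
  case succ
  show ?case by (rule exI) (rule stepped_total[OF total_rec_Suc[OF total_rec_id]])
next
  case left
  show ?case by (rule exI) (rule stepped_total[OF total_rec_p1[OF total_rec_id]])
next
  case right
  show ?case by (rule exI) (rule stepped_total[OF total_rec_p2[OF total_rec_id]])
next
  case (pair f g)
  then obtain F G where "stepped f F" "stepped g G" by blast
  then show ?case by (intro exI) (rule stepped_pair)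
next
  case (comp f g)
  then obtain F G where "stepped f F" "stepped g G" by blast
  then show ?case by (intro exI) (rule stepped_comp)
next
  case (prec f g)
  then obtain F G where "stepped f F" "stepped g G" by blast
  then show ?case by (rule stepped_prec)
next
  case (search f)
  then obtain F where "stepped f F" by blast
  then show ?case by (rule stepped_search)
qed

section \<open>Codes of binary strings\<close>

lemma str_code_Nil [simp]: "str_code [] = 0"
  by (simp add: str_code_def)

lemma str_code_snoc: "str_code (\<sigma> @ [b]) = 2 * str_code \<sigma> + (if b then 2 else 1)"
  by (simp add: str_code_def)

lemma str_code_nat_str [simp]: "str_code (nat_str n) = n"
  unfolding nat_str_def by (rule surj_f_inv_f[OF bij_is_surj[OF bij_str_code]])

lemma nat_str_str_code [simp]: "nat_str (str_code \<sigma>) = \<sigma>"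
  unfolding nat_str_def by (rule inv_f_f[OF bij_is_inj[OF bij_str_code]])

lemma nat_str_eq_iff [simp]: "nat_str m = nat_str n \<longleftrightarrow> m = n"
  by (metis str_code_nat_str)

text \<open>In binary, \<open>Suc (str_code \<sigma>)\<close> is a one followed by
  \<open>\<sigma>\<close>. Appending \<open>\<tau>\<close> shifts it by \<open>length \<tau>\<close>
  bits and adds the value \<open>r\<close> of \<open>\<tau>\<close>.\<close>

lemma str_code_append:
  "\<exists>r < 2 ^ length \<tau>. Suc (str_code (\<sigma> @ \<tau>)) = Suc (str_code \<sigma>) * 2 ^ length \<tau> + r"
proof (induction \<tau> rule: rev_induct)
  case (snoc b \<tau>)
  then obtain r where r: "r < 2 ^ length \<tau>"
    "Suc (str_code (\<sigma> @ \<tau>)) = Suc (str_code \<sigma>) * 2 ^ length \<tau> + r"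
    by blast
  have "Suc (str_code (\<sigma> @ \<tau> @ [b])) = 2 * Suc (str_code (\<sigma> @ \<tau>)) + of_bool b"
    using str_code_snoc[of "\<sigma> @ \<tau>" b] by simp
  then have "Suc (str_code (\<sigma> @ \<tau> @ [b]))
      = Suc (str_code \<sigma>) * 2 ^ length (\<tau> @ [b]) + (2 * r + of_bool b)"
    unfolding r(2) by (simp add: algebra_simps)
  moreover have "2 * r + of_bool b < 2 ^ length (\<tau> @ [b])"
    using r(1) by (cases b) auto
  ultimately show ?case by blast
qed simp

abbreviation len :: "nat \<Rightarrow> nat" where "len n \<equiv> length (nat_str n)"

text \<open>Appending to the empty string shows that \<open>Suc n\<close> is a leading one followed
  by \<open>len n\<close> bits.\<close>

lemma len_bounds: "2 ^ len n \<le> Suc n" "Suc n < 2 ^ Suc (len n)"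
  using str_code_append[of "nat_str n" "[]"] by auto

lemma len_eqI:
  assumes "2 ^ l \<le> Suc n" "Suc n < 2 ^ Suc l"
  shows "len n = l"
proof -
  have *: "(2::nat) ^ len n < 2 ^ Suc l" "(2::nat) ^ l < 2 ^ Suc (len n)"
    using assms len_bounds[of n] by linarith+
  show ?thesis
    using power_less_imp_less_exp[OF _ *(1)] power_less_imp_less_exp[OF _ *(2)] by simp
qed

lemma total_rec_len [rec_intros]:
  assumes "total_rec f"
  shows "total_rec (\<lambda>x. len (f x))"
proof -
  have *: "(\<Sum>i<n. of_bool (2 ^ Suc i \<le> Suc n)) = len n" for n
  proof -
    have "2 ^ Suc i \<le> Suc n \<longleftrightarrow> i < len n" for i
    proof
      assume "2 ^ Suc i \<le> Suc n"
      then have "(2::nat) ^ Suc i < 2 ^ Suc (len n)" using len_bounds(2)[of n] by linarith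
      then show "i < len n" by simp
    next
      assume "i < len n"
      then have "(2::nat) ^ Suc i \<le> 2 ^ len n" by (intro power_increasing) auto
      then show "2 ^ Suc i \<le> Suc n" using len_bounds(1)[of n] by linarith
    qed
    moreover have "len n \<le> n"
      using len_bounds(1)[of n] less_exp[of "len n"] by linarith
    then have "i < n" if "i < len n" for i
      using that by linarith
    ultimately have "{i \<in> {..<n}. 2 ^ Suc i \<le> Suc n} = {..<len n}"
      by blast
    then show ?thesis by (simp add: Int_def del: power_Suc)
  qed
  have "total_rec (\<lambda>n. \<Sum>i<n. of_bool (2 ^ Suc i \<le> Suc n))"
    by (intro rec_intros)
  then have "total_rec len" unfolding * .
  then show ?thesis using assms by (rule total_rec_comp)
qed

text \<open>Deleting final bits is a division by a power of two. This arithmetic form makes the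
  prefix relation on codes decidable; see \<open>is_prefix\<close>.\<close>

lemma str_code_take:
  assumes "n \<le> length \<sigma>"
  shows "str_code (take n \<sigma>) = Suc (str_code \<sigma>) div 2 ^ (length \<sigma> - n) - 1"
proof -
  obtain r where "r < 2 ^ length (drop n \<sigma>)"
    "Suc (str_code (take n \<sigma> @ drop n \<sigma>)) = Suc (str_code (take n \<sigma>)) * 2 ^ length (drop n \<sigma>) + r"
    using str_code_append by blast
  then have "Suc (str_code \<sigma>) div 2 ^ (length \<sigma> - n) = Suc (str_code (take n \<sigma>))"
    by (simp only: append_take_drop_id length_drop)
      (metis add.commute add_0 div_less div_mult_self1 power_not_zero zero_neq_numeral)
  then show ?thesis by simp
qed

section \<open>Kraft's inequality\<close>

definition weight :: "nat \<Rightarrow> real" where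
  "weight n = 1 / 2 ^ n"

lemma weight_pos [simp]: "0 < weight n" and weight_nonneg [simp]: "0 \<le> weight n"
  by (simp_all add: weight_def)

lemma weight_0 [simp]: "weight 0 = 1" and weight_Suc: "weight (Suc n) = weight n / 2"
  by (simp_all add: weight_def)

lemma weight_add: "weight (m + n) = weight m * weight n"
  by (simp add: weight_def power_add)

lemma power_diff_weight: "l \<le> n \<Longrightarrow> (2::real) ^ (n - l) = weight l * 2 ^ n"
  by (simp add: weight_def power_diff)

lemma weight_antimono: "m \<le> n \<Longrightarrow> weight n \<le> weight m"
  by (simp add: weight_def frac_le power_increasing)

lemma weight_strict_antimono: "m < n \<Longrightarrow> 2 * weight n \<le> weight m"
  using weight_antimono[of "Suc m" n] by (simp add: weight_def)

text \<open>
  The dyadic interval of \<open>\<sigma>\<close> starts at \<open>position \<sigma> - 1\<close>: the code of \<open>\<sigma>\<close> plus one is \<open>1\<sigma>\<close> in binary.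
\<close>

definition position :: "bool list \<Rightarrow> real" where
  "position \<sigma> = Suc (str_code \<sigma>) * weight (length \<sigma>)"

text \<open>Extending a string passes to a subinterval. Strings with disjoint intervals are
  therefore incomparable, which is how the constructed machine is seen to be prefix-free.\<close>

lemma position_prefix:
  assumes "prefix \<sigma> \<tau>"
  shows "position \<sigma> \<le> position \<tau>" "position \<tau> + weight (length \<tau>) \<le> position \<sigma> + weight (length \<sigma>)"
proof -
  obtain \<rho> where \<tau>: "\<tau> = \<sigma> @ \<rho>" using assms by (elim prefixE)
  obtain r where r: "r < 2 ^ length \<rho>"
    "Suc (str_code (\<sigma> @ \<rho>)) = Suc (str_code \<sigma>) * 2 ^ length \<rho> + r"
    using str_code_append by blast
  have w: "2 ^ length \<rho> * weight (length \<tau>) = weight (length \<sigma>)"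
    by (simp add: \<tau> weight_def power_add)
  have "position \<tau> = (real (Suc (str_code \<sigma>)) * 2 ^ length \<rho> + r) * weight (length \<tau>)"
    unfolding position_def \<tau> r(2) by (simp only: of_nat_add of_nat_mult of_nat_power of_nat_numeral)
  also have "\<dots> = real (Suc (str_code \<sigma>)) * (2 ^ length \<rho> * weight (length \<tau>)) + r * weight (length \<tau>)"
    by (simp add: algebra_simps)
  finally have pos: "position \<tau> = position \<sigma> + r * weight (length \<tau>)"
    by (simp only: w position_def)
  then show "position \<sigma> \<le> position \<tau>" by simp
  have "(r + 1) * weight (length \<tau>) \<le> 2 ^ length \<rho> * weight (length \<tau>)"
  proof (rule mult_right_mono)
    have "r + 1 \<le> 2 ^ length \<rho>" using r(1) by simp
    then show "real (r + 1) \<le> 2 ^ length \<rho>" by (metis of_nat_le_iff of_nat_numeral of_nat_power)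
  qed simp
  then show "position \<tau> + weight (length \<tau>) \<le> position \<sigma> + weight (length \<sigma>)"
    unfolding w pos by (simp add: algebra_simps)
qed

lemma card_extensions:
  fixes p :: "bool list"
  assumes "length p \<le> N"
  shows "card {q. length q = N \<and> prefix p q} = 2 ^ (N - length p)"
proof -
  have "{q. length q = N \<and> prefix p q} = (\<lambda>r. p @ r) ` {r. set r \<subseteq> UNIV \<and> length r = N - length p}"
    using assms by (auto simp: prefix_def)
  moreover have "card ((\<lambda>r. p @ r) ` {r. set r \<subseteq> UNIV \<and> length r = N - length p})
      = card {r :: bool list. set r \<subseteq> UNIV \<and> length r = N - length p}"
    by (intro card_image) (simp add: inj_on_def)
  ultimately show ?thesis
    by (simp only: card_lists_length_eq[OF finite_UNIV] card_UNIV_bool)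
qed

text \<open>Pad to a common length \<open>N\<close>: incomparable strings have disjoint sets of
  extensions of length \<open>N\<close>, and \<open>p\<close> takes up
  \<open>2 ^ (N - length p)\<close> of the \<open>2 ^ N\<close> strings.\<close>

lemma kraft:
  fixes F :: "bool list set"
  assumes "finite F" and pf: "\<And>p q. p \<in> F \<Longrightarrow> q \<in> F \<Longrightarrow> prefix p q \<Longrightarrow> p = q"
  shows "(\<Sum>p\<in>F. weight (length p)) \<le> 1"
proof -
  define N where "N = Max (insert 0 (length ` F))"
  have N: "length p \<le> N" if "p \<in> F" for p
    unfolding N_def using assms(1) that by (intro Max_ge) auto
  define E where "E p = {q :: bool list. length q = N \<and> prefix p q}" for p
  have fin: "finite {q :: bool list. length q = N}"
    using finite_lists_length_eq[of "UNIV :: bool set" N] by simp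
  have "(\<Sum>p\<in>F. 2 ^ (N - length p)) = (\<Sum>p\<in>F. card (E p))"
    unfolding E_def by (intro sum.cong refl card_extensions[symmetric] N)
  also have "\<dots> = card (\<Union>p\<in>F. E p)"
  proof (rule card_UN_disjoint[symmetric])
    show "\<forall>p\<in>F. finite (E p)"
      unfolding E_def by (auto intro: finite_subset[OF _ fin])
    show "\<forall>p\<in>F. \<forall>q\<in>F. p \<noteq> q \<longrightarrow> E p \<inter> E q = {}"
    proof (intro ballI impI)
      fix p q assume pq: "p \<in> F" "q \<in> F" "p \<noteq> q"
      show "E p \<inter> E q = {}"
        using prefix_same_cases[of p _ q] pf pq unfolding E_def by blast
    qed
  qed (fact assms(1))
  also have "\<dots> \<le> card {q :: bool list. length q = N}"
    by (intro card_mono fin) (auto simp: E_def)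
  also have "\<dots> = 2 ^ N"
    using card_lists_length_eq[of "UNIV :: bool set" N] by simp
  finally have "real (\<Sum>p\<in>F. 2 ^ (N - length p)) \<le> real (2 ^ N)"
    by (rule of_nat_mono)
  then have "(\<Sum>p\<in>F. 2 ^ (N - length p)) * weight N \<le> 2 ^ N * weight N"
    by (intro mult_right_mono) simp_all
  moreover have "(\<Sum>p\<in>F. 2 ^ (N - length p)) * weight N = (\<Sum>p\<in>F. weight (length p))"
    unfolding sum_distrib_right using N
    by (intro sum.cong) (auto simp: weight_def power_diff)
  moreover have "2 ^ N * weight N = 1" by (simp add: weight_def)
  ultimately show ?thesis by linarith
qed

section \<open>The machine existence theorem\<close>

lemma K_machine_le: "M p = Some \<sigma> \<Longrightarrow> K_machine M \<sigma> \<le> enat (length p)"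
  unfolding K_machine_def by (rule INF_lower) simp

lemma K_machine_attained:
  assumes "K_machine M \<sigma> \<noteq> \<infinity>"
  obtains p where "M p = Some \<sigma>" "K_machine M \<sigma> = enat (length p)"
proof -
  have ne: "{p. M p = Some \<sigma>} \<noteq> {}"
  proof
    assume "{p. M p = Some \<sigma>} = {}"
    then have "K_machine M \<sigma> = \<infinity>"
      unfolding K_machine_def by (simp add: top_enat_def)
    with assms show False ..
  qed
  then have "(INF p\<in>{p. M p = Some \<sigma>}. enat (length p)) \<in> (\<lambda>p. enat (length p)) ` {p. M p = Some \<sigma>}"
    unfolding Inf_enat_def by (auto intro: LeastI)
  then show ?thesis using that unfolding K_machine_def by blast
qed

text \<open>
  Request \<open>k\<close> receives a string of length \<open>l k + 1\<close> whose interval lies in the interval of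
  length \<open>weight (l k)\<close> that follows the intervals of the earlier requests.
\<close>

theorem machine_existence:
  fixes l out :: "nat \<Rightarrow> nat" and act :: "nat \<Rightarrow> bool"
  assumes U: "optimal_prefix_free_machine U"
    and rec: "total_rec l" "total_rec out" "decidable act"
    and budget: "\<And>N. (\<Sum>k<N. of_bool (act k) * weight (l k)) \<le> 1"
  obtains c where "\<And>k. act k \<Longrightarrow> K_machine U (nat_str (out k)) \<le> enat (l k + c)"
proof -
  \<comment> \<open>The left end of the interval reserved for request \<open>k\<close>.\<close>
  define a where "a k = (\<Sum>j<k. of_bool (act j) * weight (l j))" for k
  \<comment> \<open>An exponent that bounds all earlier lengths, so that
    \<open>a k * 2 ^ H k\<close> is an integer.\<close>
  define H where "H k = (\<Sum>j<k. l j)" for k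
  \<comment> \<open>The integer part of \<open>a k * 2 ^ Suc (l k)\<close> plus one: the first grid
    point strictly beyond \<open>a k\<close> at half the requested scale. The grid interval that
    starts there still fits into the reserved interval.\<close>
  define v where "v k = Suc ((\<Sum>j<k. of_bool (act j) * 2 ^ (H k - l j)) * 2 ^ Suc (l k) div 2 ^ H k)" for k
  \<comment> \<open>The string of length \<open>Suc (l k)\<close> that spells \<open>v k\<close> in
    binary: \<open>Suc (code k)\<close> carries the leading one.\<close>
  define code where "code k = 2 ^ Suc (l k) + v k - 1" for k
  have a_mono: "a j \<le> a k" if "j \<le> k" for j k
    unfolding a_def using that by (intro sum_mono2) auto
  have a_Suc: "a (Suc k) = a k + weight (l k)" if "act k" for k
    using that by (simp add: a_def)
  have v_bounds: "a k < v k * weight (Suc (l k))"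
    "Suc (v k) * weight (Suc (l k)) \<le> a k + weight (l k)" for k
  proof -
    let ?S = "\<Sum>j<k. of_bool (act j) * 2 ^ (H k - l j) :: nat"
    have "real ?S = (\<Sum>j<k. of_bool (act j) * (weight (l j) * 2 ^ H k))"
      unfolding of_nat_sum
    proof (intro sum.cong refl)
      fix j assume "j \<in> {..<k}"
      then have "l j \<le> H k" unfolding H_def by (intro member_le_sum) auto
      then show "real (of_bool (act j) * 2 ^ (H k - l j)) = of_bool (act j) * (weight (l j) * 2 ^ H k)"
        by (simp add: power_diff_weight)
    qed
    then have S: "real ?S = a k * 2 ^ H k"
      unfolding a_def sum_distrib_right by (simp add: mult.assoc)
    define L where "L = Suc (l k)"
    have vk: "v k = Suc (?S * 2 ^ L div 2 ^ H k)" by (simp add: v_def L_def)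
    have q: "real (?S * 2 ^ L) = a k * 2 ^ L * 2 ^ H k"
      by (simp add: S[symmetric] mult_ac)
    have "?S * 2 ^ L < v k * 2 ^ H k"
      unfolding vk mult_Suc by (rule dividend_less_div_times) simp
    then have "real (?S * 2 ^ L) < real (v k * 2 ^ H k)" by (simp only: of_nat_less_iff)
    then have "a k * 2 ^ L < v k" unfolding q by simp
    then show "a k < v k * weight (Suc (l k))"
      by (simp add: weight_def L_def[symmetric] field_simps)
    have "(v k - 1) * 2 ^ H k \<le> ?S * 2 ^ L"
      unfolding vk by simp
    then have "real ((v k - 1) * 2 ^ H k) \<le> real (?S * 2 ^ L)" by (simp only: of_nat_le_iff)
    then have "real (v k - 1) \<le> a k * 2 ^ L" unfolding q by simp
    then have "real (Suc (v k)) \<le> a k * 2 ^ L + 2" by (simp add: vk)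
    then have "Suc (v k) * weight L \<le> (a k * 2 ^ L + 2) * weight L"
      by (intro mult_right_mono) simp_all
    also have "\<dots> = a k + weight (l k)"
      by (simp add: weight_def L_def field_simps)
    finally show "Suc (v k) * weight (Suc (l k)) \<le> a k + weight (l k)"
      by (simp add: L_def)
  qed
  have len: "len (code k) = Suc (l k)" if "act k" for k
  proof (rule len_eqI)
    have "a (Suc k) \<le> 1" unfolding a_def by (rule budget)
    then have "Suc (v k) * weight (Suc (l k)) \<le> 1"
      using v_bounds(2)[of k] a_Suc[OF that] by linarith
    then have "real (Suc (v k)) \<le> real (2 ^ Suc (l k))"
      by (simp add: weight_def field_simps)
    then have "Suc (v k) \<le> 2 ^ Suc (l k)" by (simp only: of_nat_le_iff)
    then show "Suc (code k) < 2 ^ Suc (Suc (l k))" unfolding code_def by simp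
    show "2 ^ Suc (l k) \<le> Suc (code k)" unfolding code_def by simp
  qed
  have Suc_code: "Suc (code k) = 2 ^ Suc (l k) + v k" for k
    by (simp add: code_def)
  have pos: "position (nat_str (code k)) = 1 + v k * weight (Suc (l k))" if "act k" for k
    unfolding position_def len[OF that] str_code_nat_str Suc_code
    by (simp add: weight_def field_simps)
  have sep: "position (nat_str (code j)) + weight (len (code j)) < position (nat_str (code k))"
    if "act j" "act k" "j < k" for j k
    using v_bounds(2)[of j] v_bounds(1)[of k] a_Suc[OF that(1)] a_mono[of "Suc j" k] that
    by (simp add: pos len algebra_simps)
  have pf: "j = k" if "act j" "act k" "prefix (nat_str (code j)) (nat_str (code k))" for j k
  proof (cases j k rule: linorder_cases)
    case less
    then show ?thesis
      using sep[OF that(1,2)] position_prefix[OF that(3)] weight_pos[of "len (code k)"] by linarith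
  next
    case greater
    then show ?thesis
      using sep[OF that(2,1)] position_prefix[OF that(3)] weight_pos[of "len (code k)"] by linarith
  qed
  define F where "F x = (if \<exists>k. act k \<and> code k = x
    then Some (out (LEAST k. act k \<and> code k = x)) else None)" for x
  define M where "M p = map_option nat_str (F (str_code p))" for p
  have "total_rec code"
  proof -
    note r = total_rec_comp[OF rec(1)] decidable_comp[OF rec(3)]
    have "total_rec H" unfolding H_def by (intro rec_intros r)
    then show ?thesis
      unfolding code_def v_def by (intro rec_intros r total_rec_comp[OF \<open>total_rec H\<close>])
  qed
  have "partial_recursive F"
    unfolding F_def
    by (intro partial_recursive_search rec_intros rec(2) decidable_comp[OF rec(3)]
        total_rec_comp[OF \<open>total_rec code\<close>])
  moreover have "(\<lambda>n. map_option str_code (M (nat_str n))) = F"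
    by (simp add: M_def option.map_comp comp_def option.map_ident)
  ultimately have "computable_machine M"
    by (simp add: computable_machine_def)
  moreover have dom: "\<exists>k. act k \<and> p = nat_str (code k)" if "p \<in> dom M" for p
  proof -
    have "F (str_code p) \<noteq> None" using that by (auto simp: M_def)
    then obtain k where "act k" "code k = str_code p"
      by (auto simp: F_def split: if_splits)
    then show ?thesis by (metis nat_str_str_code)
  qed
  have "p = q" if "p \<in> dom M" "q \<in> dom M" "prefix p q" for p q
    using dom[OF that(1)] dom[OF that(2)] pf that(3) by blast
  ultimately have "prefix_free_machine M"
    unfolding prefix_free_machine_def by blast
  then obtain c where c: "\<And>\<sigma>. K_machine U \<sigma> \<le> K_machine M \<sigma> + enat c"
    using U unfolding optimal_prefix_free_machine_def by blast
  \<comment> \<open>The successor of \<open>c\<close> pays for the extra bit of the assigned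
    string.\<close>
  have "K_machine U (nat_str (out k)) \<le> enat (l k + Suc c)" if "act k" for k
  proof -
    \<comment> \<open>Different active requests have incomparable, hence different, strings, so the
      search returns the request itself.\<close>
    have "j = k" if "act j \<and> code j = code k" for j
      using pf[of j k] that \<open>act k\<close> by simp
    then have "(LEAST j. act j \<and> code j = code k) = k"
      using \<open>act k\<close> by (metis (mono_tags, lifting) LeastI)
    then have "M (nat_str (code k)) = Some (nat_str (out k))"
      using that by (auto simp: M_def F_def)
    from K_machine_le[of M, OF this] have "K_machine M (nat_str (out k)) \<le> enat (Suc (l k))"
      by (simp add: len[OF that])
    then have "K_machine M (nat_str (out k)) + enat c \<le> enat (Suc (l k)) + enat c"
      by (rule add_right_mono)
    with c[of "nat_str (out k)"] have "K_machine U (nat_str (out k)) \<le> enat (Suc (l k)) + enat c"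
      by (rule order_trans)
    then show ?thesis by simp
  qed
  then show ?thesis by (rule that)
qed

section \<open>The process of matched increments\<close>

declare sum_of_bool_eq [simp del] sum_mult_of_bool_eq [simp del] sum_of_bool_mult_eq [simp del]

text \<open>Scaling by \<open>2 ^ E x\<close>, where \<open>E x\<close> dominates every exponent,
  turns the comparison of dyadic rationals into one of natural numbers. Subtracted weights have to
  be moved to the other side beforehand.\<close>

lemma decidable_weighted_le:
  assumes "total_rec e" "total_rec b"
    and "decidable (\<lambda>z. P (p1 z) (p2 z))" "total_rec (\<lambda>z. \<alpha> (p1 z) (p2 z))"
    and "decidable (\<lambda>z. Q (p1 z) (p2 z))" "total_rec (\<lambda>z. \<beta> (p1 z) (p2 z))"
  shows "decidable (\<lambda>x. weight (e x) + (\<Sum>k<b x. of_bool (P x k) * weight (\<alpha> x k))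
    \<le> (\<Sum>k<b x. of_bool (Q x k) * weight (\<beta> x k)))"
proof -
  define E where "E x = e x + (\<Sum>k<b x. \<alpha> x k + \<beta> x k)" for x
  have E: "e x \<le> E x" "k < b x \<Longrightarrow> \<alpha> x k \<le> E x" "k < b x \<Longrightarrow> \<beta> x k \<le> E x" for x k
  proof -
    show "e x \<le> E x" by (simp add: E_def)
    assume "k < b x"
    then have "\<alpha> x k + \<beta> x k \<le> (\<Sum>k<b x. \<alpha> x k + \<beta> x k)"
      by (intro member_le_sum) auto
    then show "\<alpha> x k \<le> E x" "\<beta> x k \<le> E x" by (simp_all add: E_def)
  qed
  have sum: "real (\<Sum>k<b x. of_bool (R k) * 2 ^ (E x - \<gamma> k))
      = (\<Sum>k<b x. of_bool (R k) * weight (\<gamma> k)) * 2 ^ E x"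
    if "\<And>k. k < b x \<Longrightarrow> \<gamma> k \<le> E x" for x R \<gamma>
    unfolding of_nat_sum sum_distrib_right
    by (intro sum.cong refl) (simp add: that power_diff_weight)
  have "((2 :: nat) ^ (E x - e x) + (\<Sum>k<b x. of_bool (P x k) * 2 ^ (E x - \<alpha> x k))
      \<le> (\<Sum>k<b x. of_bool (Q x k) * 2 ^ (E x - \<beta> x k)))
    \<longleftrightarrow> weight (e x) + (\<Sum>k<b x. of_bool (P x k) * weight (\<alpha> x k))
      \<le> (\<Sum>k<b x. of_bool (Q x k) * weight (\<beta> x k))" (is "?l x \<longleftrightarrow> ?r x") for x
  proof -
    have sumP: "real (\<Sum>k<b x. of_bool (P x k) * 2 ^ (E x - \<alpha> x k))
        = (\<Sum>k<b x. of_bool (P x k) * weight (\<alpha> x k)) * 2 ^ E x"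
      by (rule sum) (rule E(2))
    have sumQ: "real (\<Sum>k<b x. of_bool (Q x k) * 2 ^ (E x - \<beta> x k))
        = (\<Sum>k<b x. of_bool (Q x k) * weight (\<beta> x k)) * 2 ^ E x"
      by (rule sum) (rule E(3))
    have "?l x \<longleftrightarrow> real (2 ^ (E x - e x) + (\<Sum>k<b x. of_bool (P x k) * 2 ^ (E x - \<alpha> x k)))
        \<le> real (\<Sum>k<b x. of_bool (Q x k) * 2 ^ (E x - \<beta> x k))"
      by (simp only: of_nat_le_iff)
    also have "\<dots> \<longleftrightarrow> (weight (e x) + (\<Sum>k<b x. of_bool (P x k) * weight (\<alpha> x k))) * 2 ^ E x
        \<le> (\<Sum>k<b x. of_bool (Q x k) * weight (\<beta> x k)) * 2 ^ E x"
      by (simp only: of_nat_add of_nat_power of_nat_numeral sumP sumQ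
          power_diff_weight[OF E(1)] distrib_right)
    finally show ?thesis by simp
  qed
  moreover have "decidable ?l"
  proof -
    have "total_rec E"
      unfolding E_def by (intro rec_intros assms)
    note rec = total_rec_comp[OF this] total_rec_comp[OF assms(1)]
    show ?thesis by (intro rec_intros rec assms)
  qed
  ultimately show ?thesis by simp
qed

text \<open>Components never exceed the code of a pair, so the pairs coded below \<open>N\<close>
  lie in an \<open>N\<close> by \<open>N\<close> square. Budgets of coded requests thus reduce to
  iterated sums.\<close>

lemma sum_prod_decode_le:
  fixes f :: "nat \<Rightarrow> nat \<Rightarrow> real"
  assumes "\<And>i j. 0 \<le> f i j"
  shows "(\<Sum>k<N. f (p1 k) (p2 k)) \<le> (\<Sum>i<N. \<Sum>j<N. f i j)"
proof -
  have "p1 k \<le> k" "p2 k \<le> k" for k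
    using le_prod_encode_1[of "p1 k" "p2 k"] le_prod_encode_2[of "p2 k" "p1 k"] by simp_all
  then have sub: "prod_decode ` {..<N} \<subseteq> {..<N} \<times> {..<N}"
    by (auto simp: image_subset_iff mem_Times_iff intro: le_less_trans)
  have "(\<Sum>k<N. f (p1 k) (p2 k)) = (\<Sum>z\<in>prod_decode ` {..<N}. f (fst z) (snd z))"
    by (subst sum.reindex) (auto simp: inj_on_def prod_decode_eq)
  also have "\<dots> \<le> (\<Sum>z\<in>{..<N} \<times> {..<N}. f (fst z) (snd z))"
    using sub by (intro sum_mono2) (auto simp: assms)
  also have "\<dots> = (\<Sum>i<N. \<Sum>j<N. f i j)"
    by (simp add: sum.cartesian_product case_prod_unfold)
  finally show ?thesis .
qed

text \<open>A property that persists is switched on at most once, and only if it holds at the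
  end.\<close>

lemma sum_of_bool_switch_le:
  assumes "\<And>u. b u \<Longrightarrow> b (Suc u)"
  shows "(\<Sum>u<N. of_bool (b (Suc u) \<and> \<not> b u)) \<le> (of_bool (b N) :: real)"
proof (induction N)
  case (Suc N)
  then show ?case using assms[of N] by (cases "b N"; cases "b (Suc N)") auto
qed simp

text \<open>
  An item is a pair \<open>(x, s)\<close>; it is proper if the description with code \<open>x\<close> halts exactly at
  stage \<open>s + 1\<close>, so that every description is proper once.
\<close>

locale matching =
  fixes U :: "bool list \<rightharpoonup> bool list" and T h :: "nat \<Rightarrow> nat \<Rightarrow> nat" and g :: "nat \<Rightarrow> nat"
  assumes U: "optimal_prefix_free_machine U"
    and T_rec: "total_rec (\<lambda>z. T (p1 z) (p2 z))"
    and T_mono: "\<And>x s t. 0 < T x s \<Longrightarrow> s \<le> t \<Longrightarrow> T x t = T x s"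
    and T_bound: "\<And>x s. s \<le> x \<Longrightarrow> T x s = 0"
    and T_iff: "\<And>x v. U (nat_str x) = Some (nat_str v) \<longleftrightarrow> (\<exists>s. T x s = Suc v)"
    and h_rec: "total_rec (\<lambda>z. h (p1 z) (p2 z))"
    and h_anti: "\<And>m s t. s \<le> t \<Longrightarrow> h m t \<le> h m s"
    and h_lim: "\<And>m. \<exists>s. \<forall>t\<ge>s. h m t = g m"
begin

lemma T_rec' [rec_intros]: "total_rec a \<Longrightarrow> total_rec b \<Longrightarrow> total_rec (\<lambda>x. T (a x) (b x))"
  using total_rec_comp[OF T_rec, of "\<lambda>x. prod_encode (a x, b x)"] by (simp add: total_rec_pair)

lemma h_rec' [rec_intros]: "total_rec a \<Longrightarrow> total_rec b \<Longrightarrow> total_rec (\<lambda>x. h (a x) (b x))"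
  using total_rec_comp[OF h_rec, of "\<lambda>x. prod_encode (a x, b x)"] by (simp add: total_rec_pair)

lemma g_le_h: "g m \<le> h m t"
proof -
  obtain s where "\<forall>t\<ge>s. h m t = g m" using h_lim by blast
  then have "h m (max s t) = g m" by simp
  then show ?thesis using h_anti[of t "max s t" m] by simp
qed

lemma prefix_free:
  assumes "U p = Some \<sigma>" "U q = Some \<tau>" "prefix p q"
  shows "p = q"
proof -
  have "\<forall>p\<in>dom U. \<forall>q\<in>dom U. prefix p q \<longrightarrow> p = q"
    using U unfolding optimal_prefix_free_machine_def prefix_free_machine_def by blast
  then show ?thesis using assms by blast
qed

lemma kraft_codes:
  assumes "finite X" and conv: "\<And>x. x \<in> X \<Longrightarrow> \<exists>s. 0 < T x s"
  shows "(\<Sum>x\<in>X. weight (len x)) \<le> 1"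
proof -
  have "(\<Sum>x\<in>X. weight (len x)) = (\<Sum>p\<in>nat_str ` X. weight (length p))"
    by (subst sum.reindex) (auto simp: inj_on_def)
  also have "\<dots> \<le> 1"
  proof (rule kraft)
    have dom: "\<exists>\<sigma>. U p = Some \<sigma>" if p: "p \<in> nat_str ` X" for p
    proof -
      obtain x where "x \<in> X" "p = nat_str x" using p by blast
      moreover from this obtain s where "0 < T x s" using conv by blast
      then have "T x s = Suc (T x s - 1)" by simp
      then have "U (nat_str x) = Some (nat_str (T x s - 1))" unfolding T_iff by blast
      ultimately show ?thesis by blast
    qed
    fix p q assume *: "p \<in> nat_str ` X" "q \<in> nat_str ` X" "prefix p q"
    obtain \<sigma> \<tau> where "U p = Some \<sigma>" "U q = Some \<tau>"
      using dom[OF *(1)] dom[OF *(2)] by blast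
    then show "p = q" using *(3) by (rule prefix_free)
  qed (use assms(1) in simp)
  finally show ?thesis .
qed

text \<open>The stage \<open>t\<close> approximation to \<open>weight (g m)\<close>. It is zero
  until \<open>m < t\<close>, so at every stage only finitely many \<open>m\<close>
  contribute.\<close>

definition W :: "nat \<Rightarrow> nat \<Rightarrow> real" where
  "W m t = of_bool (m < t) * weight (h m t)"

lemma W_mono: "s \<le> t \<Longrightarrow> W m s \<le> W m t"
  unfolding W_def using h_anti[of s t m] by (auto intro: weight_antimono)

lemma W_nonneg [simp]: "0 \<le> W m t"
  by (simp add: W_def)

definition proper :: "nat \<Rightarrow> bool" where
  "proper j \<longleftrightarrow> 0 < T (p1 j) (Suc (p2 j)) \<and> T (p1 j) (p2 j) = 0"

definition target :: "nat \<Rightarrow> nat" where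
  "target j = T (p1 j) (Suc (p2 j)) - 1"

definition cost :: "nat \<Rightarrow> nat" where
  "cost j = len (p1 j)"

text \<open>Halted values persist, so a code halts for the first time at one stage only. Hence a
  Kraft sum over proper items is one over different descriptions.\<close>

lemma proper_inj:
  assumes "proper i" "proper j" "p1 i = p1 j"
  shows "i = j"
proof -
  have "p2 i = p2 j"
  proof (rule ccontr)
    assume "p2 i \<noteq> p2 j"
    then consider "Suc (p2 i) \<le> p2 j" | "Suc (p2 j) \<le> p2 i" by linarith
    then show False
      using assms T_mono[of "p1 i" "Suc (p2 i)" "p2 j"] T_mono[of "p1 j" "Suc (p2 j)" "p2 i"]
      unfolding proper_def by cases auto
  qed
  then show ?thesis by (metis assms(3) prod.collapse prod_decode_inverse)
qed

lemma kraft_proper: "(\<Sum>j<N. of_bool (proper j) * weight (cost j)) \<le> 1"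
proof -
  have "(\<Sum>j<N. of_bool (proper j) * weight (cost j)) = (\<Sum>j | j < N \<and> proper j. weight (len (p1 j)))"
    by (intro sum.mono_neutral_cong_right) (auto simp: cost_def)
  also have "\<dots> = (\<Sum>x\<in>p1 ` {j. j < N \<and> proper j}. weight (len x))"
    by (subst sum.reindex) (auto simp: inj_on_def intro: proper_inj)
  also have "\<dots> \<le> 1"
    by (intro kraft_codes) (auto simp: proper_def)
  finally show ?thesis .
qed

lemma proper_exists:
  assumes "U p = Some (nat_str n)"
  obtains j where "proper j" "target j = n" "cost j = length p"
proof -
  define x where "x = str_code p"
  obtain s where s: "T x s = Suc n"
    using T_iff[of x n] assms by (auto simp: x_def)
  define r where "r = (LEAST s. 0 < T x s)"
  have r: "0 < T x r" unfolding r_def by (rule LeastI[of _ s]) (simp add: s)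
  \<comment> \<open>Nothing has halted at stage \<open>0\<close>, so the first halting stage is a
    successor, as \<open>proper\<close> demands.\<close>
  have "r \<noteq> 0" using r T_bound[of 0 x] by (intro notI) simp
  then obtain q where q: "r = Suc q" by (cases r) auto
  have "q < (LEAST s. 0 < T x s)" unfolding r_def[symmetric] q by simp
  then have "\<not> 0 < T x q" by (rule not_less_Least)
  then have "T x q = 0" by simp
  moreover have "r \<le> s" unfolding r_def by (rule Least_le) (simp add: s)
  then have "T x s = T x r" by (rule T_mono[OF r])
  then have "T x (Suc q) = Suc n" unfolding s q by (rule sym)
  ultimately have "proper (prod_encode (x, q))" "target (prod_encode (x, q)) = n"
    unfolding proper_def target_def prod_encode_inverse fst_conv snd_conv by simp_all
  moreover have "cost (prod_encode (x, q)) = length p"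
    by (simp add: cost_def x_def)
  ultimately show ?thesis by (rule that)
qed

section \<open>Increments of the approximations and the process that waits for them\<close>

definition inc :: "nat \<Rightarrow> nat \<Rightarrow> nat \<Rightarrow> real" where
  "inc n s t = (\<Sum>m<t. of_bool (n \<le> m) * (W m t - W m s))"

lemma inc_self [simp]: "inc n s s = 0"
  by (simp add: inc_def)

lemma inc_nonneg: "s \<le> t \<Longrightarrow> 0 \<le> inc n s t"
  unfolding inc_def by (intro sum_nonneg) (simp add: W_mono)

lemma inc_Suc:
  assumes "s \<le> t"
  shows "inc n s (Suc t) = inc n s t + (\<Sum>m<Suc t. of_bool (n \<le> m) * (W m (Suc t) - W m t))"
proof -
  \<comment> \<open>The additional index \<open>m = t\<close> contributes nothing, because
    \<open>W t\<close> vanishes up to stage \<open>t\<close>.\<close>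
  have *: "(\<Sum>m<Suc t. of_bool (n \<le> m) * (W m t - W m s)) = inc n s t"
    using assms by (simp add: inc_def W_def)
  show ?thesis
    unfolding *[symmetric] sum.distrib[symmetric] inc_def[of n s "Suc t"]
    by (intro sum.cong refl) (simp add: algebra_simps)
qed

text \<open>Improper items count as finished at once, so the process can run through all numbers in
  order.\<close>

definition finished :: "nat \<Rightarrow> nat \<Rightarrow> nat \<Rightarrow> nat \<Rightarrow> bool" where
  "finished d j s t \<longleftrightarrow> \<not> proper j \<or> weight (2 * d + cost j) \<le> inc (target j) s t"

text \<open>
  The state is the current item together with the stage at which it became current; it waits
  for \<open>inc\<close> to reach the fraction \<open>weight (2 * d)\<close> of the weight of the item.
\<close>

definition state :: "nat \<Rightarrow> nat \<Rightarrow> nat" where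
  "state d t = rec_nat (prod_encode (0, 0))
     (\<lambda>t z. if finished d (p1 z) (p2 z) (Suc t) then prod_encode (Suc (p1 z), Suc t) else z) t"

definition cur :: "nat \<Rightarrow> nat \<Rightarrow> nat" where "cur d t = p1 (state d t)"
definition start :: "nat \<Rightarrow> nat \<Rightarrow> nat" where "start d t = p2 (state d t)"

abbreviation advance :: "nat \<Rightarrow> nat \<Rightarrow> bool" where
  "advance d t \<equiv> finished d (cur d t) (start d t) (Suc t)"

lemma cur_0 [simp]: "cur d 0 = 0" and start_0 [simp]: "start d 0 = 0"
  by (simp_all add: cur_def start_def state_def)

lemma cur_Suc: "cur d (Suc t) = (if advance d t then Suc (cur d t) else cur d t)"
  and start_Suc: "start d (Suc t) = (if advance d t then Suc t else start d t)"
  by (simp_all add: cur_def start_def state_def)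

lemma start_le: "start d t \<le> t"
  by (induction t) (auto simp: start_Suc)

lemma finished_rec [rec_intros]:
  assumes "total_rec d" "total_rec j" "total_rec s" "total_rec t"
  shows "decidable (\<lambda>x. finished (d x) (j x) (s x) (t x))"
proof -
  \<comment> \<open>The negative part of \<open>inc\<close> moves to the left so that
    \<open>decidable_weighted_le\<close> applies.\<close>
  have *: "weight e \<le> inc n s t \<longleftrightarrow>
      weight e + (\<Sum>m<t. of_bool (n \<le> m \<and> m < s) * weight (h m s))
        \<le> (\<Sum>m<t. of_bool (n \<le> m \<and> m < t) * weight (h m t))" for e n s t
  proof -
    have "inc n s t = (\<Sum>m<t. of_bool (n \<le> m \<and> m < t) * weight (h m t))
        - (\<Sum>m<t. of_bool (n \<le> m \<and> m < s) * weight (h m s))"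
      unfolding inc_def sum_subtractf[symmetric]
      by (intro sum.cong refl) (simp add: W_def)
    then show ?thesis by linarith
  qed
  have "decidable (\<lambda>z. finished (p1 (p1 z)) (p2 (p1 z)) (p1 (p2 z)) (p2 (p2 z)))"
    unfolding finished_def proper_def target_def cost_def *
    by (intro rec_intros decidable_weighted_le)
  from decidable_comp[OF this total_rec_pair[OF total_rec_pair[OF assms(1,2)] total_rec_pair[OF assms(3,4)]]]
  show ?thesis by simp
qed

lemma state_rec [rec_intros]:
  assumes "total_rec d" "total_rec t"
  shows "total_rec (\<lambda>x. state (d x) (t x))"
proof -
  have "total_rec (\<lambda>z. state (p1 z) (p2 z))"
    unfolding state_def by (intro rec_intros)
  from total_rec_comp[OF this total_rec_pair[OF assms]] show ?thesis by simp
qed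

lemma cur_rec [rec_intros]: "total_rec d \<Longrightarrow> total_rec t \<Longrightarrow> total_rec (\<lambda>x. cur (d x) (t x))"
  and start_rec [rec_intros]: "total_rec d \<Longrightarrow> total_rec t \<Longrightarrow> total_rec (\<lambda>x. start (d x) (t x))"
  unfolding cur_def start_def by (intro rec_intros; assumption)+

text \<open>Either the item has just become current and nothing has been seen yet, or the last check
  failed and the increase is below the threshold. Overshoot can only occur in the step that
  completes an item.\<close>

lemma inc_le_weight:
  assumes "proper (cur d t)"
  shows "inc (target (cur d t)) (start d t) t \<le> weight (2 * d + cost (cur d t))"
  using assms
proof (induction t)
  case (Suc t)
  show ?case
  proof (cases "advance d t")
    case True
    then show ?thesis by (simp add: start_Suc)
  next
    case False
    then show ?thesis unfolding start_Suc cur_Suc finished_def by simp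
  qed
qed simp

subsection \<open>Waiting forever\<close>

text \<open>While item \<open>cur d t\<close> waits, every change of \<open>h m\<close> yields a short description of \<open>m\<close>.\<close>

definition act1 :: "nat \<Rightarrow> nat \<Rightarrow> nat \<Rightarrow> bool" where
  "act1 d t m \<longleftrightarrow> \<not> advance d t \<and> target (cur d t) \<le> m \<and> m \<le> t \<and> (m = t \<or> h m (Suc t) \<noteq> h m t)"

text \<open>When \<open>h m\<close> drops, the weight at least doubles, so half of the new weight is
  fresh increase; for \<open>m = t\<close> all of it is.\<close>

lemma act1_W:
  assumes "act1 d t m"
  shows "W m (Suc t) \<le> 2 * (W m (Suc t) - W m t)"
proof (cases "m = t")
  case False
  then have "m < t" "h m (Suc t) < h m t"
    using assms h_anti[of t "Suc t" m] by (auto simp: act1_def)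
  then show ?thesis using weight_strict_antimono[of "h m (Suc t)" "h m t"] by (simp add: W_def)
qed (simp add: W_def)

lemma act1_sum_le:
  assumes "\<not> advance d t"
  shows "(\<Sum>m<Suc t. of_bool (act1 d t m) * W m (Suc t))
    \<le> 2 * (inc (target (cur d t)) (start d t) (Suc t) - inc (target (cur d t)) (start d t) t)"
proof -
  have "(\<Sum>m<Suc t. of_bool (act1 d t m) * W m (Suc t))
      \<le> (\<Sum>m<Suc t. 2 * (of_bool (target (cur d t) \<le> m) * (W m (Suc t) - W m t)))"
  proof (rule sum_mono)
    fix m
    show "of_bool (act1 d t m) * W m (Suc t) \<le> 2 * (of_bool (target (cur d t) \<le> m) * (W m (Suc t) - W m t))"
    proof (cases "act1 d t m")
      case True
      moreover from True have "target (cur d t) \<le> m" by (simp add: act1_def)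
      ultimately show ?thesis using act1_W by simp
    qed (simp add: W_mono)
  qed
  then show ?thesis
    by (simp only: inc_Suc[OF start_le] sum_distrib_left[symmetric]) simp
qed

text \<open>Completed items are charged their full threshold and the current one its increase so
  far. A completing step makes no request, and \<open>inc_le_weight\<close> then replaces the
  increase by the full threshold.\<close>

lemma act1_budget_aux:
  "(\<Sum>t<N. \<Sum>m<Suc t. of_bool (act1 d t m) * W m (Suc t))
    \<le> 2 * ((\<Sum>j<cur d N. of_bool (proper j) * weight (2 * d + cost j))
        + of_bool (proper (cur d N)) * inc (target (cur d N)) (start d N) N)"
proof (induction N)
  case (Suc N)
  define a where "a t = (\<Sum>m<Suc t. of_bool (act1 d t m) * W m (Suc t))" for t
  show ?case
  proof (cases "advance d N")
    case True
    have "a N = 0" using True by (simp add: a_def act1_def)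
    moreover have "of_bool (proper (cur d N)) * inc (target (cur d N)) (start d N) N
        \<le> of_bool (proper (cur d N)) * weight (2 * d + cost (cur d N))"
      using inc_le_weight[of d N] by simp
    ultimately show ?thesis
      using Suc True unfolding a_def[symmetric] by (simp add: cur_Suc start_Suc)
  next
    case False
    then have "proper (cur d N)" by (simp add: finished_def)
    then show ?thesis
      using Suc act1_sum_le[OF False] False unfolding a_def[symmetric]
      by (simp add: cur_Suc start_Suc)
  qed
qed simp

lemma act1_budget:
  "(\<Sum>t<N. \<Sum>m<Suc t. of_bool (act1 d t m) * W m (Suc t)) \<le> 2 * weight (2 * d)"
proof -
  define r where "r = (\<Sum>j<cur d N. of_bool (proper j) * weight (2 * d + cost j))
        + of_bool (proper (cur d N)) * inc (target (cur d N)) (start d N) N"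
  have "r \<le> (\<Sum>j<Suc (cur d N). of_bool (proper j) * weight (2 * d + cost j))"
    using inc_le_weight[of d N] by (simp add: r_def)
  also have "\<dots> = weight (2 * d) * (\<Sum>j<Suc (cur d N). of_bool (proper j) * weight (cost j))"
    unfolding sum_distrib_left by (simp add: weight_add mult_ac)
  also have "\<dots> \<le> weight (2 * d) * 1"
    by (intro mult_left_mono kraft_proper) simp
  finally show ?thesis using act1_budget_aux[of d N, folded r_def] by linarith
qed

text \<open>A smaller exponent would by itself lift the increase above the threshold and end the
  wait. The bound keeps the subtraction of \<open>d\<close> in the requested lengths from being
  truncated.\<close>

lemma act1_exponent:
  assumes "act1 d t m"
  shows "2 * d \<le> h m (Suc t)"
proof (rule ccontr)
  have wait: "\<not> advance d t" using assms unfolding act1_def by (rule conjunct1)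
  assume "\<not> ?thesis"
  then have "2 * weight (2 * d) \<le> weight (h m (Suc t))"
    by (intro weight_strict_antimono) simp
  also have "\<dots> = of_bool (act1 d t m) * W m (Suc t)"
    using assms by (simp add: W_def act1_def)
  also have "\<dots> \<le> (\<Sum>m<Suc t. of_bool (act1 d t m) * W m (Suc t))"
    using assms by (intro member_le_sum) (auto simp: act1_def)
  also have "\<dots> \<le> 2 * inc (target (cur d t)) (start d t) (Suc t)"
    by (rule order_trans[OF act1_sum_le[OF wait]]) (simp add: inc_nonneg start_le)
  also have "\<dots> < 2 * weight (2 * d + cost (cur d t))"
    using wait unfolding finished_def by simp
  also have "\<dots> \<le> 2 * weight (2 * d)"
    by (simp add: weight_antimono)
  finally show False by simp
qed

text \<open>One machine serves all \<open>d\<close>, so the constant \<open>c\<close> does not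
  depend on \<open>d\<close> and \<open>d\<close> may be chosen after it. The requests for
  \<open>d\<close> weigh at most \<open>2 ^ d / 4 * (2 * weight (2 * d))\<close>, which is
  \<open>weight (Suc d)\<close>; these bounds sum to less than one.\<close>

lemma waiting_descriptions:
  obtains c where "\<And>d t m. act1 d t m \<Longrightarrow> K_machine U (nat_str m) \<le> enat (h m (Suc t) + 2 - d + c)"
proof -
  define act where "act k = act1 (p1 k) (p1 (p2 k)) (p2 (p2 k))" for k
  define l where "l k = h (p2 (p2 k)) (Suc (p1 (p2 k))) + 2 - p1 k" for k
  have budget: "(\<Sum>k<N. of_bool (act k) * weight (l k)) \<le> 1" for N
  proof -
    let ?f = "\<lambda>d t m. of_bool (act1 d t m) * weight (h m (Suc t) + 2 - d)"
    have "(\<Sum>k<N. of_bool (act k) * weight (l k)) \<le> (\<Sum>d<N. \<Sum>k<N. ?f d (p1 k) (p2 k))"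
      unfolding act_def l_def by (rule sum_prod_decode_le[of "\<lambda>d k. ?f d (p1 k) (p2 k)"]) simp
    also have "\<dots> \<le> (\<Sum>d<N. \<Sum>t<N. \<Sum>m<N. ?f d t m)"
      by (intro sum_mono sum_prod_decode_le) simp
    also have "\<dots> \<le> (\<Sum>d<N. weight (Suc d))"
    proof (rule sum_mono)
      fix d
      have f: "?f d t m = 2 ^ d / 4 * (of_bool (act1 d t m) * W m (Suc t))" for t m
      proof (cases "act1 d t m")
        case True
        then have "d \<le> h m (Suc t) + 2" "m < Suc t"
          using act1_exponent[OF True] by (auto simp: act1_def)
        then show ?thesis using True by (simp add: W_def weight_def power_diff power_add)
      qed simp
      have "(\<Sum>m<N. ?f d t m) \<le> (\<Sum>m<Suc t. ?f d t m)" for t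
      proof -
        have "(\<Sum>m<N. ?f d t m) = (\<Sum>m\<in>{..<N} \<inter> {..<Suc t}. ?f d t m)"
          by (intro sum.mono_neutral_right) (auto simp: act1_def)
        also have "\<dots> \<le> (\<Sum>m<Suc t. ?f d t m)"
          by (intro sum_mono2) auto
        finally show ?thesis .
      qed
      then have "(\<Sum>t<N. \<Sum>m<N. ?f d t m) \<le> (\<Sum>t<N. \<Sum>m<Suc t. ?f d t m)"
        by (intro sum_mono)
      also have "\<dots> = 2 ^ d / 4 * (\<Sum>t<N. \<Sum>m<Suc t. of_bool (act1 d t m) * W m (Suc t))"
        unfolding f sum_distrib_left ..
      also have "\<dots> \<le> 2 ^ d / 4 * (2 * weight (2 * d))"
        by (intro mult_left_mono act1_budget) simp
      also have "\<dots> = (2 ^ d * weight d) * weight d / 2"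
        unfolding mult_2[of d] weight_add by simp
      also have "2 ^ d * weight d = 1" by (simp add: weight_def)
      finally have "(\<Sum>t<N. \<Sum>m<N. ?f d t m) \<le> 1 * weight d / 2" .
      then show "(\<Sum>t<N. \<Sum>m<N. ?f d t m) \<le> weight (Suc d)"
        by (simp only: weight_Suc mult_1)
    qed
    also have "\<dots> = 1 - weight N"
      by (induction N) (simp_all add: weight_Suc)
    finally show ?thesis using weight_nonneg[of N] by linarith
  qed
  have "total_rec l" "total_rec (\<lambda>k. p2 (p2 k))" "decidable act"
    unfolding l_def act_def act1_def target_def by (intro rec_intros)+
  then obtain c
    where c: "\<And>k. act k \<Longrightarrow> K_machine U (nat_str (p2 (p2 k))) \<le> enat (l k + c)"
    by (rule machine_existence[OF U _ _ _ budget]) blast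
  show ?thesis
  proof (rule that)
    fix d t m assume "act1 d t m"
    then show "K_machine U (nat_str m) \<le> enat (h m (Suc t) + 2 - d + c)"
      using c[of "prod_encode (d, prod_encode (t, m))"] by (simp add: act_def l_def)
  qed
qed

lemma stuck_act1:
  assumes stuck: "\<And>t. t0 \<le> t \<Longrightarrow> \<not> advance d t" and m: "t0 \<le> m" "target (cur d t0) \<le> m"
  obtains t where "act1 d t m" "h m (Suc t) = g m"
proof -
  have cur: "cur d t = cur d t0" if "t0 \<le> t" for t
    using that
  proof (induction t rule: dec_induct)
    case (step i)
    then show ?case using stuck[OF step.hyps(1)] unfolding cur_Suc by (simp only: if_False)
  qed simp
  obtain s where s: "\<forall>t\<ge>s. h m t = g m" using h_lim by blast
  \<comment> \<open>At the first stage beyond \<open>m\<close> with the final value, either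
    \<open>m\<close> has just entered or \<open>h m\<close> has just changed; both make
    \<open>act1\<close> hold one stage earlier.\<close>
  define r where "r = (LEAST t. m < t \<and> h m t = g m)"
  have ex: "m < max s (Suc m) \<and> h m (max s (Suc m)) = g m"
    using s by simp
  have r: "m < r" "h m r = g m"
    using LeastI[of "\<lambda>t. m < t \<and> h m t = g m", OF ex] unfolding r_def by blast+
  obtain t where t: "r = Suc t" using r(1) by (cases r) auto
  have "m = t \<or> h m t \<noteq> g m"
    using not_less_Least[of t "\<lambda>t. m < t \<and> h m t = g m"] r(1) t unfolding r_def by linarith
  moreover have "m \<le> t" using r(1) t by simp
  ultimately have "act1 d t m"
    unfolding act1_def using stuck[of t] cur[of t] m r(2) t by auto
  then show ?thesis using that r(2) t by blast
qed

lemma never_stuck: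
  assumes inf: "\<exists>\<^sub>\<infinity>n. enat (g n) \<le> K_nat U n + enat c"
  obtains d where "\<And>t0. \<exists>t\<ge>t0. advance d t"
proof -
  obtain b where b: "\<And>d t m. act1 d t m \<Longrightarrow> K_machine U (nat_str m) \<le> enat (h m (Suc t) + 2 - d + b)"
    by (rule waiting_descriptions) blast
  \<comment> \<open>Chosen so that the length \<open>g m + 2 - d + b\<close> is smaller than
    \<open>g m - c\<close>, the lower bound on the complexity of infinitely many
    \<open>m\<close>.\<close>
  define d where "d = b + c + 3"
  have "\<exists>t\<ge>t0. advance d t" for t0
  proof (rule ccontr)
    assume "\<not> ?thesis"
    then have stuck: "\<And>t. t0 \<le> t \<Longrightarrow> \<not> advance d t" by blast
    obtain m where m: "max t0 (target (cur d t0)) \<le> m" "enat (g m) \<le> K_nat U m + enat c"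
      using inf[unfolded INFM_nat_le, rule_format, of "max t0 (target (cur d t0))"] by blast
    have m': "t0 \<le> m" "target (cur d t0) \<le> m" using m(1) by simp_all
    obtain t where t: "act1 d t m" "h m (Suc t) = g m"
      by (rule stuck_act1[OF _ m']) (use stuck in blast)+
    \<comment> \<open>Excludes truncation, so the inequality between natural numbers below is really
      contradictory.\<close>
    have "2 * d \<le> g m" using act1_exponent[OF t(1)] t(2) by simp
    have "enat (g m) \<le> enat (g m + 2 - d + b) + enat c"
      using m(2) b[OF t(1)] unfolding t(2) K_nat_def
      by (meson add_right_mono order_trans)
    then have "g m \<le> g m + 2 - d + b + c" by simp
    with \<open>2 * d \<le> g m\<close> show False by (simp add: d_def)
  qed
  then show ?thesis by (rule that)
qed

lemma item_completed:
  assumes inf: "\<And>t0. \<exists>t\<ge>t0. advance d t"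
  obtains t where "cur d t = j" "advance d t"
proof -
  have next_adv: "\<exists>t'. cur d t' = cur d t \<and> advance d t'" for t
  proof -
    define r where "r = (LEAST r. t \<le> r \<and> advance d r)"
    have r: "t \<le> r" "advance d r"
      using LeastI_ex[of "\<lambda>r. t \<le> r \<and> advance d r"] inf[of t] unfolding r_def by blast+
    have wait: "\<not> advance d i" if "t \<le> i" "i < r" for i
      using not_less_Least[of i "\<lambda>r. t \<le> r \<and> advance d r"] that unfolding r_def by blast
    have "i \<le> r \<Longrightarrow> cur d i = cur d t" if "t \<le> i" for i
      using that
    proof (induction i rule: dec_induct)
      case (step i)
      then show ?case using wait[of i] unfolding cur_Suc by simp
    qed simp
    then have "cur d r = cur d t" using r(1) by blast
    then show ?thesis using r(2) by blast
  qed
  have "\<exists>t. cur d t = j"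
  proof (induction j)
    case 0
    show ?case by (rule exI[of _ 0]) simp
  next
    case (Suc j)
    then obtain t where "cur d t = j" "advance d t" using next_adv by blast
    then show ?case by (intro exI[of _ "Suc t"]) (simp add: cur_Suc)
  qed
  then show ?thesis using next_adv that by blast
qed

subsection \<open>Short descriptions of initial segments\<close>

definition is_prefix :: "nat \<Rightarrow> nat \<Rightarrow> nat \<Rightarrow> bool" where
  "is_prefix n \<tau> \<sigma> \<longleftrightarrow> n \<le> len \<sigma> \<and> Suc \<sigma> div 2 ^ (len \<sigma> - n) - 1 = \<tau>"

definition described :: "nat \<Rightarrow> nat \<Rightarrow> nat \<Rightarrow> bool" where
  "described \<sigma> l u \<longleftrightarrow> (\<exists>x<u. T x u = Suc \<sigma> \<and> len x \<le> l)"

text \<open>Besides persistence this uses that the search range \<open>x < u\<close> grows. By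
  \<open>T_bound\<close> that range misses no code halted by stage \<open>u\<close>.\<close>

lemma described_mono: "described \<sigma> l u \<Longrightarrow> u \<le> v \<Longrightarrow> described \<sigma> l v"
  unfolding described_def by (metis T_mono order.strict_trans2 zero_less_Suc)

text \<open>
  The share of \<open>inc (target (cur d t)) (start d t) (t + 1)\<close> that is covered by \<open>U\<close>-descriptions,
  found by stage \<open>u\<close>, of extensions of the string with code \<open>\<tau>\<close>.
\<close>

definition share :: "nat \<Rightarrow> nat \<Rightarrow> nat \<Rightarrow> nat \<Rightarrow> nat \<Rightarrow> real" where
  "share d c t u \<tau> = (\<Sum>\<sigma><2 ^ Suc t.
     of_bool (is_prefix (target (cur d t)) \<tau> \<sigma> \<and> described \<sigma> (h (len \<sigma>) (Suc t) + c) u)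
       * (W (len \<sigma>) (Suc t) - W (len \<sigma>) (start d t)))"

lemma W_start_le [simp]: "W m (start d t) \<le> W m (Suc t)"
  using W_mono[of "start d t" "Suc t" m] start_le[of d t] by simp

lemma W_diff_nonneg: "0 \<le> W m (Suc t) - W m (start d t)"
  by simp

lemma share_mono: "u \<le> v \<Longrightarrow> share d c t u \<tau> \<le> share d c t v \<tau>"
  unfolding share_def
  by (intro sum_mono mult_right_mono W_diff_nonneg) (auto dest: described_mono)

definition large :: "nat \<Rightarrow> nat \<Rightarrow> nat \<Rightarrow> nat \<Rightarrow> nat \<Rightarrow> bool" where
  "large d c t u \<tau> \<longleftrightarrow> weight (2 * d + cost (cur d t)) \<le> share d c t u \<tau>"

text \<open>Fires only at the step \<open>u\<close> at which the share crosses the threshold, so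
  each \<open>\<tau>\<close> is requested at most once for each completed item.\<close>

definition act2 :: "nat \<Rightarrow> nat \<Rightarrow> nat \<Rightarrow> nat \<Rightarrow> nat \<Rightarrow> bool" where
  "act2 d c t u \<tau> \<longleftrightarrow> proper (cur d t) \<and> advance d t \<and> large d c t (Suc u) \<tau> \<and> \<not> large d c t u \<tau>"

lemma large_rec [rec_intros]:
  assumes "total_rec t" "total_rec u" "total_rec \<tau>"
  shows "decidable (\<lambda>x. large d c (t x) (u x) (\<tau> x))"
proof -
  define R where "R t u \<tau> \<sigma> \<longleftrightarrow>
    is_prefix (target (cur d t)) \<tau> \<sigma> \<and> described \<sigma> (h (len \<sigma>) (Suc t) + c) u" for t u \<tau> \<sigma>
  have *: "large d c t u \<tau> \<longleftrightarrow>
      weight (2 * d + cost (cur d t)) + (\<Sum>\<sigma><2 ^ Suc t.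
        of_bool (R t u \<tau> \<sigma> \<and> len \<sigma> < start d t) * weight (h (len \<sigma>) (start d t)))
      \<le> (\<Sum>\<sigma><2 ^ Suc t. of_bool (R t u \<tau> \<sigma> \<and> len \<sigma> < Suc t) * weight (h (len \<sigma>) (Suc t)))"
    for t u \<tau>
  proof -
    have "share d c t u \<tau> = (\<Sum>\<sigma><2 ^ Suc t. of_bool (R t u \<tau> \<sigma> \<and> len \<sigma> < Suc t) * weight (h (len \<sigma>) (Suc t)))
      - (\<Sum>\<sigma><2 ^ Suc t. of_bool (R t u \<tau> \<sigma> \<and> len \<sigma> < start d t) * weight (h (len \<sigma>) (start d t)))"
      unfolding share_def R_def[symmetric] sum_subtractf[symmetric]
      by (intro sum.cong refl) (simp add: W_def)
    then show ?thesis unfolding large_def by linarith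
  qed
  have "decidable (\<lambda>z. large d c (p1 (p1 z)) (p2 (p1 z)) (p2 z))"
    unfolding * R_def is_prefix_def described_def target_def cost_def
    by (intro rec_intros decidable_weighted_le)
  from decidable_comp[OF this total_rec_pair[OF total_rec_pair[OF assms(1,2)] assms(3)]]
  show ?thesis by simp
qed

text \<open>For a fixed \<open>\<sigma>\<close> the intervals from \<open>start d t\<close> to
  \<open>t + 1\<close> of completed items are disjoint, so the increases add up to at most the
  latest \<open>W\<close>. At the last counted stage that is at most
  \<open>weight (h (len \<sigma>) (Suc t))\<close>, and some description of \<open>\<sigma>\<close>
  has length at most that exponent plus \<open>c\<close>.\<close>

lemma act2_budget_one:
  "(\<Sum>t<N. of_bool (proper (cur d t) \<and> advance d t \<and> described \<sigma> (h (len \<sigma>) (Suc t) + c) M)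
      * (W (len \<sigma>) (Suc t) - W (len \<sigma>) (start d t)))
    * weight c \<le> (\<Sum>x<M. of_bool (T x M = Suc \<sigma>) * weight (len x))"
    (is "?S N * weight c \<le> ?P")
proof -
  have "?S N \<le> W (len \<sigma>) (start d N) \<and> ?S N * weight c \<le> ?P"
  proof (induction N)
    case 0
    show ?case by (simp add: sum_nonneg)
  next
    case (Suc t)
    show ?case
    proof (cases "proper (cur d t) \<and> advance d t \<and> described \<sigma> (h (len \<sigma>) (Suc t) + c) M")
      case True
      then have S: "?S (Suc t) \<le> W (len \<sigma>) (Suc t)" "start d (Suc t) = Suc t"
        using Suc.IH by (simp_all add: start_Suc)
      obtain x where x: "x < M" "T x M = Suc \<sigma>" "len x \<le> h (len \<sigma>) (Suc t) + c"
        using True unfolding described_def by blast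
      have "?S (Suc t) * weight c \<le> weight (h (len \<sigma>) (Suc t)) * weight c"
      proof (rule mult_right_mono)
        have "W (len \<sigma>) (Suc t) \<le> weight (h (len \<sigma>) (Suc t))" by (simp add: W_def)
        with S(1) show "?S (Suc t) \<le> weight (h (len \<sigma>) (Suc t))" by (rule order_trans)
      qed simp
      also have "\<dots> \<le> weight (len x)"
        using x(3) by (simp only: weight_add[symmetric] weight_antimono)
      also have "\<dots> = of_bool (T x M = Suc \<sigma>) * weight (len x)" using x(2) by simp
      also have "\<dots> \<le> ?P" using x(1) by (intro member_le_sum) auto
      finally show ?thesis using S by simp
    next
      case False
      then have eq: "?S (Suc t) = ?S t" by simp
      have "W (len \<sigma>) (start d t) \<le> W (len \<sigma>) (start d (Suc t))"
        using start_le[of d t] by (intro W_mono) (simp add: start_Suc)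
      from order_trans[OF conjunct1[OF Suc.IH] this] conjunct2[OF Suc.IH] show ?thesis
        unfolding eq by (rule conjI)
    qed
  qed
  then show ?thesis by blast
qed

text \<open>Each request is paid by its share times \<open>weight c\<close>. Regrouping the shares
  by \<open>\<sigma>\<close> charges them to descriptions of \<open>\<sigma>\<close>, and Kraft's
  inequality for \<open>U\<close> bounds the total.\<close>

lemma act2_budget:
  "(\<Sum>t<N. \<Sum>u<N. \<Sum>\<tau><N. of_bool (act2 d c t u \<tau>) * weight (2 * d + c + cost (cur d t))) \<le> 1"
proof -
  let ?adv = "\<lambda>t. proper (cur d t) \<and> advance d t"
  let ?D = "\<lambda>\<sigma> t. W (len \<sigma>) (Suc t) - W (len \<sigma>) (start d t)"
  let ?Q = "\<lambda>\<sigma> t. described \<sigma> (h (len \<sigma>) (Suc t) + c) N"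
  have "(\<Sum>u<N. \<Sum>\<tau><N. of_bool (act2 d c t u \<tau>) * weight (2 * d + c + cost (cur d t)))
      \<le> (\<Sum>\<sigma><2 ^ N. of_bool (?adv t \<and> ?Q \<sigma> t) * ?D \<sigma> t) * weight c" if "t < N" for t
  proof (cases "?adv t")
    case True
    have "(\<Sum>u<N. of_bool (act2 d c t u \<tau>) * weight (2 * d + c + cost (cur d t)))
        \<le> share d c t N \<tau> * weight c" for \<tau>
    proof -
      have "large d c t u \<tau> \<Longrightarrow> large d c t (Suc u) \<tau>" for u
        unfolding large_def using share_mono[of u "Suc u"] by (meson le_SucI order_refl order_trans)
      note switch = sum_of_bool_switch_le[of "\<lambda>u. large d c t u \<tau>" N, OF this]
      have w: "weight (2 * d + c + cost (cur d t)) = weight (2 * d + cost (cur d t)) * weight c"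
        by (simp add: weight_add)
      have "(\<Sum>u<N. of_bool (act2 d c t u \<tau>) * weight (2 * d + c + cost (cur d t)))
          = (\<Sum>u<N. of_bool (large d c t (Suc u) \<tau> \<and> \<not> large d c t u \<tau>))
            * weight (2 * d + cost (cur d t)) * weight c"
        using True unfolding w sum_distrib_right by (simp add: act2_def mult.assoc)
      also have "\<dots> \<le> of_bool (large d c t N \<tau>) * weight (2 * d + cost (cur d t)) * weight c"
        by (intro mult_right_mono switch) simp_all
      also have "\<dots> \<le> share d c t N \<tau> * weight c"
      proof (rule mult_right_mono)
        have "0 \<le> share d c t N \<tau>"
          unfolding share_def by (intro sum_nonneg mult_nonneg_nonneg W_diff_nonneg) simp
        then show "of_bool (large d c t N \<tau>) * weight (2 * d + cost (cur d t)) \<le> share d c t N \<tau>"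
          by (simp add: large_def)
      qed simp
      finally show ?thesis .
    qed
    then have "(\<Sum>\<tau><N. \<Sum>u<N. of_bool (act2 d c t u \<tau>) * weight (2 * d + c + cost (cur d t)))
        \<le> (\<Sum>\<tau><N. share d c t N \<tau>) * weight c"
      unfolding sum_distrib_right by (intro sum_mono)
    also have "\<dots> \<le> (\<Sum>\<sigma><2 ^ N. of_bool (?adv t \<and> ?Q \<sigma> t) * ?D \<sigma> t) * weight c"
    proof (rule mult_right_mono)
      have "(\<Sum>\<tau><N. share d c t N \<tau>) = (\<Sum>\<sigma><2 ^ Suc t. \<Sum>\<tau><N.
          of_bool (is_prefix (target (cur d t)) \<tau> \<sigma>) * (of_bool (?Q \<sigma> t) * ?D \<sigma> t))"
        unfolding share_def by (subst sum.swap) (simp add: of_bool_conj mult.assoc)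
      also have "\<dots> \<le> (\<Sum>\<sigma><2 ^ Suc t. of_bool (?Q \<sigma> t) * ?D \<sigma> t)"
      proof (rule sum_mono)
        fix \<sigma>
        \<comment> \<open>The only possible prefix of \<open>\<sigma>\<close> of the target length:
          \<open>\<sigma>\<close> adds to the share of at most one \<open>\<tau>\<close>.\<close>
        let ?\<rho> = "Suc \<sigma> div 2 ^ (len \<sigma> - target (cur d t)) - 1"
        have "(\<Sum>\<tau><N. of_bool (is_prefix (target (cur d t)) \<tau> \<sigma>) :: real)
            \<le> (\<Sum>\<tau><N. if \<tau> = ?\<rho> then 1 else 0)"
          by (intro sum_mono) (simp add: is_prefix_def)
        also have "\<dots> \<le> 1" by simp
        finally have "(\<Sum>\<tau><N. of_bool (is_prefix (target (cur d t)) \<tau> \<sigma>)) * (of_bool (?Q \<sigma> t) * ?D \<sigma> t)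
            \<le> 1 * (of_bool (?Q \<sigma> t) * ?D \<sigma> t)"
          by (intro mult_right_mono mult_nonneg_nonneg W_diff_nonneg) simp_all
        then show "(\<Sum>\<tau><N. of_bool (is_prefix (target (cur d t)) \<tau> \<sigma>) * (of_bool (?Q \<sigma> t) * ?D \<sigma> t))
            \<le> of_bool (?Q \<sigma> t) * ?D \<sigma> t"
          by (simp only: sum_distrib_right mult_1)
      qed
      also have "\<dots> \<le> (\<Sum>\<sigma><2 ^ N. of_bool (?Q \<sigma> t) * ?D \<sigma> t)"
      proof (rule sum_mono2)
        have "(2::nat) ^ Suc t \<le> 2 ^ N" using \<open>t < N\<close> by (intro power_increasing) auto
        then show "{..<2 ^ Suc t} \<subseteq> {..<2 ^ N :: nat}" by (simp only: lessThan_subset_iff)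
      qed (auto intro: mult_nonneg_nonneg W_diff_nonneg)
      finally show "(\<Sum>\<tau><N. share d c t N \<tau>) \<le> (\<Sum>\<sigma><2 ^ N. of_bool (?adv t \<and> ?Q \<sigma> t) * ?D \<sigma> t)"
        using True by simp
    qed simp
    finally show ?thesis by (subst sum.swap)
  next
    case False
    then have "act2 d c t u \<tau> = False" for u \<tau> by (auto simp: act2_def)
    then show ?thesis
      by (simp add: sum_nonneg W_diff_nonneg)
  qed
  then have "(\<Sum>t<N. \<Sum>u<N. \<Sum>\<tau><N. of_bool (act2 d c t u \<tau>) * weight (2 * d + c + cost (cur d t)))
      \<le> (\<Sum>t<N. (\<Sum>\<sigma><2 ^ N. of_bool (?adv t \<and> ?Q \<sigma> t) * ?D \<sigma> t) * weight c)"
    by (intro sum_mono) auto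
  also have "\<dots> = (\<Sum>\<sigma><2 ^ N. (\<Sum>t<N. of_bool (?adv t \<and> ?Q \<sigma> t) * ?D \<sigma> t) * weight c)"
    unfolding sum_distrib_right by (rule sum.swap)
  also have "\<dots> \<le> (\<Sum>\<sigma><2 ^ N. \<Sum>x<N. of_bool (T x N = Suc \<sigma>) * weight (len x))"
    using act2_budget_one[where M = N and N = N] by (intro sum_mono) (simp only: conj_assoc)
  also have "\<dots> = (\<Sum>x<N. (\<Sum>\<sigma><2 ^ N. of_bool (T x N = Suc \<sigma>)) * weight (len x))"
    unfolding sum_distrib_right by (rule sum.swap)
  \<comment> \<open>A description has a single value, so it is charged for one string only.\<close>
  also have "\<dots> \<le> (\<Sum>x<N. of_bool (0 < T x N) * weight (len x))"
  proof (intro sum_mono mult_right_mono)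
    fix x
    have "(\<Sum>\<sigma><2 ^ N. of_bool (T x N = Suc \<sigma>) :: real)
        \<le> (\<Sum>\<sigma><2 ^ N. if \<sigma> = T x N - 1 then of_bool (0 < T x N) else 0)"
      by (intro sum_mono) auto
    also have "\<dots> \<le> of_bool (0 < T x N)" by simp
    finally show "(\<Sum>\<sigma><2 ^ N. of_bool (T x N = Suc \<sigma>) :: real) \<le> of_bool (0 < T x N)" .
  qed simp
  also have "\<dots> = (\<Sum>x | x < N \<and> 0 < T x N. weight (len x))"
    by (intro sum.mono_neutral_cong_right) auto
  also have "\<dots> \<le> 1"
    by (intro kraft_codes) auto
  finally show ?thesis .
qed

lemma completion_descriptions:
  obtains b where "\<And>t u \<tau>. act2 d c t u \<tau> \<Longrightarrow>
    K_machine U (nat_str \<tau>) \<le> enat (2 * d + c + cost (cur d t) + b)"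
proof -
  define act where "act k = act2 d c (p1 k) (p1 (p2 k)) (p2 (p2 k))" for k
  define l where "l k = 2 * d + c + cost (cur d (p1 k))" for k
  have budget: "(\<Sum>k<N. of_bool (act k) * weight (l k)) \<le> 1" for N
  proof -
    let ?f = "\<lambda>t u \<tau>. of_bool (act2 d c t u \<tau>) * weight (2 * d + c + cost (cur d t))"
    have "(\<Sum>k<N. of_bool (act k) * weight (l k)) \<le> (\<Sum>t<N. \<Sum>k<N. ?f t (p1 k) (p2 k))"
      unfolding act_def l_def by (rule sum_prod_decode_le[of "\<lambda>t k. ?f t (p1 k) (p2 k)"]) simp
    also have "\<dots> \<le> (\<Sum>t<N. \<Sum>u<N. \<Sum>\<tau><N. ?f t u \<tau>)"
      by (intro sum_mono sum_prod_decode_le) simp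
    also have "\<dots> \<le> 1" by (rule act2_budget)
    finally show ?thesis .
  qed
  have "total_rec l" "total_rec (\<lambda>k. p2 (p2 k))" "decidable act"
    unfolding l_def act_def act2_def cost_def proper_def by (intro rec_intros)+
  then obtain b
    where b: "\<And>k. act k \<Longrightarrow> K_machine U (nat_str (p2 (p2 k))) \<le> enat (l k + b)"
    by (rule machine_existence[OF U _ _ _ budget]) blast
  show ?thesis
  proof (rule that)
    fix t u \<tau> assume "act2 d c t u \<tau>"
    then show "K_machine U (nat_str \<tau>) \<le> enat (2 * d + c + cost (cur d t) + b)"
      using b[of "prod_encode (t, prod_encode (u, \<tau>))"] by (simp add: act_def l_def)
  qed
qed

section \<open>Initial segments of a sequence with complexity bounded by \<open>g\<close>\<close>

lemma length_seq_prefix [simp]: "length (A \<restriction> n) = n"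
  by (simp add: seq_prefix_def)

lemma described_eventually:
  assumes "K_machine U \<sigma> \<le> enat l"
  obtains u where "\<And>v. u \<le> v \<Longrightarrow> described (str_code \<sigma>) l v"
proof -
  have "K_machine U \<sigma> \<noteq> \<infinity>"
  proof
    assume "K_machine U \<sigma> = \<infinity>"
    with assms show False by simp
  qed
  then obtain q where q: "U q = Some \<sigma>" "K_machine U \<sigma> = enat (length q)"
    by (rule K_machine_attained)
  then have "U (nat_str (str_code q)) = Some (nat_str (str_code \<sigma>))" by simp
  then obtain s where s: "T (str_code q) s = Suc (str_code \<sigma>)" unfolding T_iff by blast
  have "str_code q < s" using T_bound[of s "str_code q"] s by (cases "str_code q < s") auto
  then have "described (str_code \<sigma>) l s"
    unfolding described_def using s assms q(2) by (intro exI[of _ "str_code q"]) simp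
  then show ?thesis using that described_mono by blast
qed

text \<open>For \<open>m\<close> at least the target, \<open>A \<restriction> m\<close> extends the
  initial segment of target length. These strings are different, one for each term of
  \<open>inc\<close>, and all of them are described.\<close>

lemma inc_le_share:
  assumes A: "\<And>m. m \<le> t \<Longrightarrow> described (str_code (A \<restriction> m)) (h m (Suc t) + c) u"
  shows "inc (target (cur d t)) (start d t) (Suc t) \<le> share d c t u (str_code (A \<restriction> target (cur d t)))"
proof -
  define n where "n = target (cur d t)"
  define f where "f \<sigma> = of_bool (is_prefix n (str_code (A \<restriction> n)) \<sigma> \<and> described \<sigma> (h (len \<sigma>) (Suc t) + c) u)
    * (W (len \<sigma>) (Suc t) - W (len \<sigma>) (start d t))" for \<sigma>
  define B where "B m = str_code (A \<restriction> m)" for m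
  have len_B: "len (B m) = m" for m by (simp add: B_def)
  have "is_prefix n (B n) (B m)" if "n \<le> m" for m
  proof -
    have "take n (A \<restriction> m) = A \<restriction> n" using that by (simp add: seq_prefix_def take_map)
    then show ?thesis
      using str_code_take[of n "A \<restriction> m"] that by (simp add: is_prefix_def B_def)
  qed
  then have f_B: "of_bool (n \<le> m) * (W m (Suc t) - W m (start d t)) \<le> f (B m)" if "m < Suc t" for m
    using A[of m] that W_diff_nonneg by (simp add: f_def B_def[symmetric] len_B)
  have "inc n (start d t) (Suc t) \<le> (\<Sum>m<Suc t. f (B m))"
    unfolding inc_def using f_B by (intro sum_mono) auto
  also have "\<dots> = (\<Sum>\<sigma>\<in>B ` {..<Suc t}. f \<sigma>)"
    by (subst sum.reindex) (auto simp: inj_on_def intro: len_B[THEN subst] dest: arg_cong[of _ _ len] simp: len_B)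
  also have "\<dots> \<le> (\<Sum>\<sigma><2 ^ Suc t. f \<sigma>)"
  proof (rule sum_mono2)
    \<comment> \<open>A string of length \<open>m\<close> has a code below \<open>2 ^ Suc m\<close>,
      so the range in \<open>share\<close> contains all strings of length at most
      \<open>t\<close>.\<close>
    show "B ` {..<Suc t} \<subseteq> {..<2 ^ Suc t}"
    proof (rule image_subsetI)
      fix m assume "m \<in> {..<Suc t}"
      then have "(2::nat) ^ Suc m \<le> 2 ^ Suc t" by (intro power_increasing) auto
      then show "B m \<in> {..<2 ^ Suc t}"
        using len_bounds(2)[of "B m"] unfolding len_B lessThan_iff by linarith
    qed
  qed (auto simp: f_def intro: mult_nonneg_nonneg W_diff_nonneg)
  finally show ?thesis by (simp add: share_def f_def n_def)
qed

theorem K_prefix_le: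
  assumes inf: "\<exists>\<^sub>\<infinity>n. enat (g n) \<le> K_nat U n + enat c'"
    and A: "\<And>m. K_machine U (A \<restriction> m) \<le> enat (g m + c)"
  obtains b where "\<And>n p. U p = Some (nat_str n) \<Longrightarrow> K_machine U (A \<restriction> n) \<le> enat (length p + b)"
proof -
  obtain d where d: "\<And>t0. \<exists>t\<ge>t0. advance d t"
    by (rule never_stuck[OF inf]) blast
  obtain b where b: "\<And>t u \<tau>. act2 d c t u \<tau> \<Longrightarrow>
      K_machine U (nat_str \<tau>) \<le> enat (2 * d + c + cost (cur d t) + b)"
    by (rule completion_descriptions) blast
  have "K_machine U (A \<restriction> n) \<le> enat (length p + (2 * d + c + b))" if p: "U p = Some (nat_str n)" for n p
  proof -
    obtain j where j: "proper j" "target j = n" "cost j = length p"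
      by (rule proper_exists[OF p]) blast
    obtain t where t: "cur d t = j" "advance d t"
      by (rule item_completed[OF d]) blast
    have "\<exists>u. \<forall>v\<ge>u. described (str_code (A \<restriction> m)) (h m (Suc t) + c) v" for m
    proof -
      \<comment> \<open>Approximation is from above, so the hypothesis on \<open>g\<close> also
        bounds the complexity by the current value of \<open>h\<close>.\<close>
      have "K_machine U (A \<restriction> m) \<le> enat (h m (Suc t) + c)"
        using A[of m] g_le_h[of m "Suc t"] by (meson add_le_mono1 enat_ord_simps(1) order_trans)
      then show ?thesis by (rule described_eventually) blast
    qed
    then obtain u where u: "\<And>m v. u m \<le> v \<Longrightarrow> described (str_code (A \<restriction> m)) (h m (Suc t) + c) v"
      by metis
    let ?\<tau> = "str_code (A \<restriction> n)"
    \<comment> \<open>A stage by which all initial segments of length at most \<open>t\<close> are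
      described.\<close>
    define v where "v = (\<Sum>m<Suc t. u m)"
    have "u m \<le> v" if "m \<le> t" for m
      unfolding v_def using that by (intro member_le_sum) auto
    then have "inc n (start d t) (Suc t) \<le> share d c t v ?\<tau>"
      using inc_le_share[of t A c v d] u t(1) j(2) by simp
    then have "large d c t v ?\<tau>"
      using t j unfolding large_def finished_def by simp
    define r where "r = (LEAST v. large d c t v ?\<tau>)"
    have r: "large d c t r ?\<tau>" unfolding r_def by (rule LeastI) fact
    \<comment> \<open>At stage \<open>0\<close> nothing is described and the share is zero, so the
      threshold is first met at a successor and \<open>act2\<close> fires just before it.\<close>
    have "\<not> large d c t 0 ?\<tau>"
      by (simp add: large_def share_def described_def not_le)
    then obtain w where w: "r = Suc w" using r by (cases r) auto
    have "\<not> large d c t w ?\<tau>"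
      using not_less_Least[of w "\<lambda>v. large d c t v ?\<tau>"] w by (simp add: r_def)
    then have "act2 d c t w ?\<tau>"
      unfolding act2_def using r w t j by simp
    from b[OF this] show ?thesis by (simp add: t(1) j(3) add_ac)
  qed
  then show ?thesis by (rule that)
qed

end

section \<open>Step counts for the given machine, and the equivalence\<close>

lemma machine_stepped:
  assumes "computable_machine U"
  obtains T where "total_rec (\<lambda>z. T (p1 z) (p2 z))"
    "\<And>x s t. 0 < T x s \<Longrightarrow> s \<le> t \<Longrightarrow> T x t = T x s"
    "\<And>x s. s \<le> x \<Longrightarrow> T x s = 0"
    "\<And>x v. U (nat_str x) = Some (nat_str v) \<longleftrightarrow> (\<exists>s. T x s = Suc v)"
proof -
  obtain F where F: "stepped (\<lambda>n. map_option str_code (U (nat_str n))) F"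
    using partial_recursive_stepped assms unfolding computable_machine_def by blast
  \<comment> \<open>The cutoff lets only codes below the stage halt, so bounded searches over codes
    are exhaustive.\<close>
  define T where "T x s = (if x < s then F x s else 0)" for x s
  show ?thesis
  proof (rule that)
    show "total_rec (\<lambda>z. T (p1 z) (p2 z))"
      unfolding T_def by (intro rec_intros stepped_rec[OF F])
    show "T x t = T x s" if "0 < T x s" "s \<le> t" for x s t
      using that stepped_eq[OF F, of x s t] by (auto simp: T_def split: if_splits)
    show "T x s = 0" if "s \<le> x" for x s using that by (simp add: T_def)
    show "U (nat_str x) = Some (nat_str v) \<longleftrightarrow> (\<exists>s. T x s = Suc v)" for x v
    proof -
      have "U (nat_str x) = Some (nat_str v) \<longleftrightarrow> map_option str_code (U (nat_str x)) = Some v"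
        by (metis (no_types, lifting) map_option_eq_Some nat_str_str_code str_code_nat_str)
      also have "\<dots> \<longleftrightarrow> (\<exists>s. F x s = Suc v)" by (rule stepped_iff[OF F])
      also have "\<dots> \<longleftrightarrow> (\<exists>s. T x s = Suc v)"
      proof
        assume "\<exists>s. F x s = Suc v"
        then obtain s where "F x s = Suc v" ..
        then have "F x (max s (Suc x)) = Suc v" by (rule stepped_mono[OF F]) simp
        then have "T x (max s (Suc x)) = Suc v" by (simp add: T_def)
        then show "\<exists>s. T x s = Suc v" ..
      next
        assume "\<exists>s. T x s = Suc v"
        then show "\<exists>s. F x s = Suc v" by (metis T_def nat.distinct(1))
      qed
      finally show ?thesis .
    qed
  qed
qed

theorem mainTheorem9:
  fixes U :: "bool list \<rightharpoonup> bool list" and g :: "nat \<Rightarrow> nat" and A :: "nat \<Rightarrow> bool"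
  assumes "optimal_prefix_free_machine U"
    and "weak_Solovay_function U g"
  shows "K_trivial U A \<longleftrightarrow> (\<exists>c::nat. \<forall>n. K_machine U (A \<restriction> n) \<le> enat (g n + c))"
proof
  obtain c1 where c1: "\<And>n. K_nat U n \<le> enat (g n + c1)"
    using assms(2) unfolding weak_Solovay_function_def by blast
  {
    assume "K_trivial U A"
    then obtain c where c: "\<And>n. K_machine U (A \<restriction> n) \<le> K_nat U n + enat c"
      unfolding K_trivial_def by blast
    \<comment> \<open>This direction uses only that \<open>g\<close> bounds the complexity of
      \<open>n\<close> from above.\<close>
    have "K_machine U (A \<restriction> n) \<le> enat (g n + (c1 + c))" for n
    proof -
      have "K_nat U n + enat c \<le> enat (g n + c1) + enat c"
        using c1 by (rule add_right_mono)
      with c[of n] have "K_machine U (A \<restriction> n) \<le> enat (g n + c1) + enat c"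
        by (rule order_trans)
      then show ?thesis by (simp add: add_ac)
    qed
    then show "\<exists>c::nat. \<forall>n. K_machine U (A \<restriction> n) \<le> enat (g n + c)" by blast
  }
  assume "\<exists>c::nat. \<forall>n. K_machine U (A \<restriction> n) \<le> enat (g n + c)"
  then obtain c where A: "\<And>n. K_machine U (A \<restriction> n) \<le> enat (g n + c)" by blast
  obtain h where h: "computable2 h" "\<And>n. antimono (h n)" "\<And>n. \<exists>s. \<forall>t\<ge>s. h n t = g n"
    using assms(2) unfolding weak_Solovay_function_def right_ce_def by blast
  obtain c2 where inf: "\<exists>\<^sub>\<infinity>n. enat (g n) \<le> K_nat U n + enat c2"
    using assms(2) unfolding weak_Solovay_function_def by blast
  have "computable_machine U"
    using assms(1) unfolding optimal_prefix_free_machine_def prefix_free_machine_def by blast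
  then obtain T where T: "total_rec (\<lambda>z. T (p1 z) (p2 z))"
    "\<And>x s t. 0 < T x s \<Longrightarrow> s \<le> t \<Longrightarrow> T x t = T x s"
    "\<And>x s. s \<le> x \<Longrightarrow> T x s = 0"
    "\<And>x v. U (nat_str x) = Some (nat_str v) \<longleftrightarrow> (\<exists>s. T x s = Suc v)"
    by (rule machine_stepped) blast
  interpret matching U T h g
  proof
    show "total_rec (\<lambda>z. h (p1 z) (p2 z))"
      using h(1) unfolding computable2_def total_rec_def .
    show "h m t \<le> h m s" if "s \<le> t" for m s t
      using h(2)[of m] that by (rule antimonoD)
  qed (fact assms(1) T h(3))+
  obtain b where b: "\<And>n p. U p = Some (nat_str n) \<Longrightarrow> K_machine U (A \<restriction> n) \<le> enat (length p + b)"
    by (rule K_prefix_le[OF inf A]) blast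
  have "K_machine U (A \<restriction> n) \<le> K_nat U n + enat b" for n
  proof -
    \<comment> \<open>The finite bound by \<open>g\<close> guarantees a shortest description of
      \<open>n\<close>, to which \<open>b\<close> applies.\<close>
    have "K_machine U (nat_str n) \<noteq> \<infinity>"
    proof
      assume "K_machine U (nat_str n) = \<infinity>"
      with c1[of n] show False by (simp add: K_nat_def)
    qed
    then obtain p where "U p = Some (nat_str n)" "K_machine U (nat_str n) = enat (length p)"
      by (rule K_machine_attained)
    then show ?thesis using b[of p n] by (simp add: K_nat_def)
  qed
  then show "K_trivial U A" unfolding K_trivial_def by blast
qed

end
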